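(* Let $(\mathbf G,\mathbf X)$ be a Shimura datum of Hodge type. For every symplectic embedding $\psi:(\mathbf G,\mathbf X)\hookrightarrow(GSp(2g),\mathbf X_g)$ into a Siegel Shimura datum, the Hodge character $\eta_\omega(\psi)=\psi^*\eta_g$ is quasi-constant (with respect to the base field $\mathbf Q$).
   Context: $\mathbf S=\mathrm{Res}_{\mathbf C/\mathbf R}\mathbf G_m$, and $\overline{\mathbf Q}$ is the algebraic closure of $\mathbf Q$ in $\mathbf C$. $GSp(2g)=GSp(V,Q)$ is the group of symplectic similitudes of a $2g$-dimensional $\mathbf Q$-vector space $V$ with non-degenerate alternating form $Q$; $\mathbf X_g$ is the $GSp(2g,\mathbf R)$-conjugacy class of homomorphisms $\mathbf S\to GSp(2g)_{\mathbf R}$ defining Hodge structures of type $\{(-1,0),(0,-1)\}$ on $V_{\mathbf R}$ polarized by $\pm Q$. A symplectic embedding $\psi$ is an injective homomorphism of $\mathbf Q$-groups $\mathbf G\to GSp(2g)$ with $\psi\circ h\in\mathbf X_g$ for $h\in\mathbf X$; a Shimura datum is of Hodge type if it admits one. For $h\in\mathbf X$ let $\mu_h(z)=(h\otimes\mathbf C)(z,1)$, a cocharacter of $\mathbf G_{\mathbf C}$. Let $\mathbf T\subset\mathbf G$ be a maximal torus over $\mathbf Q$ and let $\mu\in X_*(\mathbf T)$ (defined over $\overline{\mathbf Q}$) be a representative of the conjugacy class of $\mu_h$. Set $\mathbf L=\mathrm{Cent}_{\mathbf G_{\overline{\mathbf Q}}}(\mu)$, $\mu_g=\psi\circ\mu$,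 $\mathbf L_g=\mathrm{Cent}_{GSp(2g)_{\overline{\mathbf Q}}}(\mu_g)$; thus $\psi(\mathbf L)\subset\mathbf L_g$. One has $V_{\overline{\mathbf Q}}=V^{-1,0}\oplus V^{0,-1}$, where $\mu_g(z)$ acts by $z$ on $V^{-1,0}$ and trivially on $V^{0,-1}$; both are representations of $\mathbf L_g$. The character $\eta_g\in X^*(\mathbf L_g)$ is $\det(V^{-1,0})^{-1}$; it is the character giving rise to the Hodge line bundle $\omega_g=\det\mathrm{Fil}^1H^1_{\mathrm{dR}}$ of the Siegel Shimura variety. The Hodge character is $\eta_\omega(\psi)=\psi^*\eta_g\in X^*(\mathbf L)\subset X^*(\mathbf T)$. Let $\Phi$ be the roots of $(\mathbf G_{\overline{\mathbf Q}},\mathbf T_{\overline{\mathbf Q}})$ and $W$ the Weyl group. A character $\chi\in X^*(\mathbf T)$ is quasi-constant if for every $\alpha\in\Phi$ with $\langle\chi,\alpha^\vee\rangle\neq0$ and every $\sigma\in W\rtimes\mathrm{Gal}(\overline{\mathbf Q}/\mathbf Q)$ one has $\langle\chi,\sigma\alpha^\vee\rangle/\langle\chi,\alpha^\vee\rangle\in\{-1,0,1\}$. *)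

theory Defs
  imports
    "HOL-Analysis.Analysis"
    "HOL-Algebra.Group_Action"
begin

section \<open>Linear algebraic groups in characteristic zero\<close>

text \<open>
  Every affine algebraic group over a subfield \<open>K\<close> of the complex numbers is smooth and isomorphic
  to a closed subgroup of some \<open>GL_n\<close>. It is represented here by its group of complex points, a
  subgroup of \<open>GL_n(C)\<close> which is the zero locus of polynomials with coefficients in \<open>K\<close>; morphisms
  over \<open>K\<close> are maps given by regular functions with coefficients in \<open>K\<close>. The ground fields used are
  \<open>\<rat>\<close>, \<open>\<real>\<close> (as subsets of the complex numbers), \<open>Qbar\<close> and \<open>UNIV\<close>.
\<close>

type_synonym 'n cmat = "complex ^ 'n ^ 'n"

definition Qbar :: "complex set" where
  "Qbar = {z. algebraic z}"

definition GL :: "('n::finite cmat) monoid" where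
  "GL = \<lparr>carrier = {A. invertible A}, mult = (**), one = mat 1\<rparr>"

definition mgroup :: "('n::finite cmat) set \<Rightarrow> ('n cmat) monoid" where
  "mgroup G = GL\<lparr>carrier := G\<rparr>"

definition conj_by :: "'n::finite cmat \<Rightarrow> 'n cmat \<Rightarrow> 'n cmat" where
  "conj_by g A = g ** A ** matrix_inv g"

inductive_set poly_fun :: "complex set \<Rightarrow> ('n::finite cmat \<Rightarrow> complex) set"
  for K :: "complex set" where
  const: "c \<in> K \<Longrightarrow> (\<lambda>A. c) \<in> poly_fun K"
| coord: "(\<lambda>A. A $ i $ j) \<in> poly_fun K"
| add: "p \<in> poly_fun K \<Longrightarrow> q \<in> poly_fun K \<Longrightarrow> (\<lambda>A. p A + q A) \<in> poly_fun K"
| mult: "p \<in> poly_fun K \<Longrightarrow> q \<in> poly_fun K \<Longrightarrow> (\<lambda>A. p A * q A) \<in> poly_fun K"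

definition regular_on :: "complex set \<Rightarrow> ('n::finite cmat) set \<Rightarrow> ('n cmat \<Rightarrow> complex) \<Rightarrow> bool" where
  "regular_on K G f \<longleftrightarrow> (\<exists>p \<in> poly_fun K. \<exists>k::nat. \<forall>g\<in>G. f g = p g / det g ^ k)"

definition zariski_closed :: "complex set \<Rightarrow> ('n::finite cmat) set \<Rightarrow> bool" where
  "zariski_closed K Z \<longleftrightarrow>
     (\<exists>F \<subseteq> poly_fun K. Z = {A. invertible A \<and> (\<forall>f\<in>F. f A = 0)})"

definition alg_group :: "complex set \<Rightarrow> ('n::finite cmat) set \<Rightarrow> bool" where
  "alg_group K G \<longleftrightarrow> subgroup G GL \<and> zariski_closed K G"

definition alg_hom ::
  "complex set \<Rightarrow> ('m::finite cmat) set \<Rightarrow> ('n::finite cmat) set \<Rightarrow> ('m cmat \<Rightarrow> 'n cmat) \<Rightarrow> bool" where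
  "alg_hom K G H f \<longleftrightarrow>
     f \<in> hom (mgroup G) (mgroup H) \<and> (\<forall>i j. regular_on K G (\<lambda>g. f g $ i $ j))"

definition points :: "complex set \<Rightarrow> ('n::finite cmat) set \<Rightarrow> ('n cmat) set" where
  "points K G = {A \<in> G. \<forall>i j. A $ i $ j \<in> K}"

definition centralizer :: "('n::finite cmat) set \<Rightarrow> ('n cmat) set \<Rightarrow> ('n cmat) set" where
  "centralizer G S = {g \<in> G. \<forall>s\<in>S. g ** s = s ** g}"

definition zariski_connected :: "('n::finite cmat) set \<Rightarrow> bool" where
  "zariski_connected G \<longleftrightarrow>
     \<not> (\<exists>A B. zariski_closed UNIV A \<and> zariski_closed UNIV B \<and> A \<noteq> {} \<and> B \<noteq> {} \<and>
            A \<inter> B = {} \<and> A \<union> B = G)"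

definition identity_component :: "('n::finite cmat) set \<Rightarrow> ('n cmat) set" where
  "identity_component G = \<Union>{C. alg_group UNIV C \<and> zariski_connected C \<and> C \<subseteq> G}"

definition unipotent :: "'n::finite cmat \<Rightarrow> bool" where
  "unipotent u \<longleftrightarrow> (\<exists>k. \<forall>v. ((\<lambda>v. (u - mat 1) *v v) ^^ k) v = 0)"

text \<open>Reductivity is the geometric condition that the unipotent radical over the algebraically
  closed field is trivial.\<close>

definition connected_reductive :: "('n::finite cmat) set \<Rightarrow> bool" where
  "connected_reductive G \<longleftrightarrow>
     zariski_connected G \<and>
     (\<forall>U. alg_group UNIV U \<and> zariski_connected U \<and> normal U (mgroup G) \<and> (\<forall>u\<in>U. unipotent u)
        \<longrightarrow> U = {mat 1})"

text \<open>The complexified Lie algebra: the Zariski tangent space at the identity.\<close>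

definition Lie :: "('n::finite cmat) set \<Rightarrow> ('n cmat) set" where
  "Lie G = {A. \<forall>f \<in> poly_fun UNIV. (\<forall>g\<in>G. f g = 0) \<longrightarrow>
              ((\<lambda>t. f (mat 1 + mat t ** A)) has_field_derivative 0) (at 0)}"


section \<open>Tori, characters and cocharacters\<close>

definition split_torus :: "'n set \<Rightarrow> ('n::finite cmat) set" where
  "split_torus I = {\<chi> i j. if i = j then d i else 0 |d. (\<forall>i. d i \<noteq> 0) \<and> (\<forall>i. i \<notin> I \<longrightarrow> d i = 1)}"

text \<open>A torus is a group isomorphic over \<open>Qbar\<close> to a power of the multiplicative group. The rank of a
  torus in \<open>GL_n\<close> is at most \<open>n\<close>, so every power that can occur is realised as the group of diagonal
  \<open>n \<times> n\<close> matrices supported on an index subset.\<close>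

definition torus :: "('n::finite cmat) set \<Rightarrow> bool" where
  "torus T \<longleftrightarrow> alg_group Qbar T \<and>
     (\<exists>I f f'. alg_hom Qbar T (split_torus I :: ('n cmat) set) f \<and> alg_hom Qbar (split_torus I) T f' \<and>
        (\<forall>t\<in>T. f' (f t) = t) \<and> (\<forall>d\<in>split_torus I. f (f' d) = d))"

definition maximal_torus :: "complex set \<Rightarrow> ('n::finite cmat) set \<Rightarrow> ('n cmat) set \<Rightarrow> bool" where
  "maximal_torus K G T \<longleftrightarrow> alg_group K T \<and> T \<subseteq> G \<and> torus T \<and>
     (\<forall>T'. torus T' \<and> T \<subseteq> T' \<and> T' \<subseteq> G \<longrightarrow> T' = T)"

definition Gm :: "(1 cmat) set" where
  "Gm = {A. invertible A}"

text \<open>Characters and cocharacters over \<open>Qbar\<close>; the multiplicative group is \<open>GL_1\<close>, whose elements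
  are identified with nonzero complex numbers (the value of a cocharacter at 0 is irrelevant).\<close>

definition characters :: "('n::finite cmat) set \<Rightarrow> ('n cmat \<Rightarrow> complex) set" where
  "characters T = {c. alg_hom Qbar T Gm (\<lambda>t. mat (c t))}"

definition cocharacters :: "('n::finite cmat) set \<Rightarrow> (complex \<Rightarrow> 'n cmat) set" where
  "cocharacters T = {l. alg_hom Qbar Gm T (\<lambda>A. l (A $ 1 $ 1))}"

definition pairing :: "('n::finite cmat \<Rightarrow> complex) \<Rightarrow> (complex \<Rightarrow> 'n cmat) \<Rightarrow> int" where
  "pairing c l = (THE k. \<forall>z \<in> Qbar - {0}. c (l z) = z powi k)"

definition roots :: "('n::finite cmat) set \<Rightarrow> ('n cmat) set \<Rightarrow> ('n cmat \<Rightarrow> complex) set" where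
  "roots G T = {a \<in> characters T. (\<exists>t\<in>T. a t \<noteq> 1) \<and>
     (\<exists>A \<in> Lie G. A \<noteq> 0 \<and> (\<forall>t\<in>T. conj_by t A = mat (a t) ** A))}"

text \<open>
  For a root \<open>a\<close> let \<open>G_a\<close> be the centralizer of the identity component of \<open>ker a\<close>. The Weyl group
  of \<open>(G_a, T)\<close> has exactly one nontrivial element \<open>s\<close>, and the coroot of \<open>a\<close> is the unique
  cocharacter \<open>b\<close> with \<open>\<langle>a, b\<rangle> = 2\<close> such that \<open>s l = l - \<langle>a, l\<rangle> b\<close> for all cocharacters \<open>l\<close>.
  It is rendered as a relation between \<open>a\<close> and \<open>b\<close>; cocharacters are written multiplicatively.
\<close>

definition is_coroot ::
  "('n::finite cmat) set \<Rightarrow> ('n cmat) set \<Rightarrow> ('n cmat \<Rightarrow> complex) \<Rightarrow> (complex \<Rightarrow> 'n cmat) \<Rightarrow> bool" where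
  "is_coroot G T a b \<longleftrightarrow> b \<in> cocharacters T \<and> pairing a b = 2 \<and>
     (\<exists>n \<in> points Qbar (normalizer
              (mgroup (centralizer G (identity_component {t\<in>T. a t = 1}))) T).
        \<forall>l \<in> cocharacters T. \<forall>z. z \<noteq> 0 \<longrightarrow>
          conj_by n (l z) = l z ** b (z powi (- pairing a l)))"

definition Gal_Qbar :: "(complex \<Rightarrow> complex) set" where
  "Gal_Qbar = {s. bij_betw s Qbar Qbar \<and>
     (\<forall>x\<in>Qbar. \<forall>y\<in>Qbar. s (x + y) = s x + s y \<and> s (x * y) = s x * s y) \<and>
     (\<forall>q\<in>\<rat>. s q = q)}"

text \<open>
  The action of the element \<open>w s\<close> of the semidirect product of the Weyl group and the Galois group
  on cocharacters, where \<open>n\<close> is a \<open>Qbar\<close>-point of the normalizer of \<open>T\<close> representing \<open>w\<close>. The formula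
  is meaningful on \<open>Qbar\<close>-points, which determine a cocharacter defined over \<open>Qbar\<close> and are the
  only ones inspected by \<open>pairing\<close>.
\<close>

definition weyl_galois_act ::
  "'n::finite cmat \<Rightarrow> (complex \<Rightarrow> complex) \<Rightarrow> (complex \<Rightarrow> 'n cmat) \<Rightarrow> complex \<Rightarrow> 'n cmat" where
  "weyl_galois_act n s l = (\<lambda>z. conj_by n (map_matrix s (l (inv_into Qbar s z))))"

definition quasi_constant ::
  "('n::finite cmat) set \<Rightarrow> ('n cmat) set \<Rightarrow> ('n cmat \<Rightarrow> complex) \<Rightarrow> bool" where
  "quasi_constant G T c \<longleftrightarrow> c \<in> characters T \<and>
     (\<forall>a \<in> roots G T. \<forall>b. is_coroot G T a b \<and> pairing c b \<noteq> 0 \<longrightarrow>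
        (\<forall>n \<in> points Qbar (normalizer (mgroup G) T). \<forall>s \<in> Gal_Qbar.
           rat_of_int (pairing c (weyl_galois_act n s b)) / rat_of_int (pairing c b) \<in> {-1, 0, 1}))"


section \<open>The Deligne torus and Hodge structures\<close>

text \<open>The Weil restriction of the multiplicative group from \<open>C\<close> to \<open>R\<close>, embedded in \<open>GL_2\<close> through
  the regular representation in the basis \<open>1, i\<close>.\<close>

definition deligne_torus :: "(2 cmat) set" where
  "deligne_torus = {A. invertible A \<and> A $ 1 $ 1 = A $ 2 $ 2 \<and> A $ 1 $ 2 = - A $ 2 $ 1}"

text \<open>The identification of its complex points with pairs \<open>(z, w)\<close> of nonzero complex numbers, under
  which the real point \<open>z\<close> corresponds to \<open>(z, cnj z)\<close>.\<close>

definition deligne_pt :: "complex \<Rightarrow> complex \<Rightarrow> 2 cmat" where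
  "deligne_pt z w = vector [vector [(z + w) / 2, (w - z) / (2 * \<i>)],
                            vector [(z - w) / (2 * \<i>), (z + w) / 2]]"

text \<open>A representation \<open>r\<close> of the Deligne torus on a complex space: the component of type \<open>(p, q)\<close> is
  the subspace where \<open>(z, w)\<close> acts as \<open>z\<close> to the \<open>-p\<close> times \<open>w\<close> to the \<open>-q\<close>.\<close>

definition hodge_component ::
  "(complex \<Rightarrow> 'a \<Rightarrow> 'a) \<Rightarrow> (complex \<Rightarrow> complex \<Rightarrow> 'a \<Rightarrow> 'a) \<Rightarrow> 'a set \<Rightarrow> int \<times> int \<Rightarrow> 'a set" where
  "hodge_component sc r U pq = {v \<in> U. \<forall>z w. z \<noteq> 0 \<and> w \<noteq> 0 \<longrightarrow>
     r z w v = sc (z powi (- fst pq) * w powi (- snd pq)) v}"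

definition has_hodge_types ::
  "(complex \<Rightarrow> 'a::ab_group_add \<Rightarrow> 'a) \<Rightarrow> (complex \<Rightarrow> complex \<Rightarrow> 'a \<Rightarrow> 'a) \<Rightarrow> 'a set \<Rightarrow>
     (int \<times> int) set \<Rightarrow> bool" where
  "has_hodge_types sc r U P \<longleftrightarrow>
     (\<forall>v\<in>U. \<exists>x. (\<forall>pq\<in>P. x pq \<in> hodge_component sc r U pq) \<and> v = (\<Sum>pq\<in>P. x pq))"


section \<open>Shimura data\<close>

text \<open>Conjugation by \<open>g\<close> on the Lie algebra. For connected reductive \<open>G\<close> the image of \<open>Ad\<close> is the
  group of complex points of the adjoint group, realised in a function space whose (product) topology
  restricts to the usual topology on linear endomorphisms.\<close>

definition Ad :: "('n::finite cmat) set \<Rightarrow> 'n cmat \<Rightarrow> 'n cmat \<Rightarrow> 'n cmat" where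
  "Ad G g = restrict (conj_by g) (Lie G)"

text \<open>
  Deligne's axioms. Here \<open>h (deligne_pt \<i> (-\<i>))\<close> is \<open>h(i)\<close>. In the second axiom, that conjugation by
  \<open>h(i)\<close> is a Cartan involution of the real adjoint group means that the real form of the adjoint
  group fixed by \<open>g \<mapsto> h(i) (cnj g) h(i)^{-1}\<close> is compact. In the third axiom, a factor over the
  rationals of the adjoint group \<open>G/Z\<close> is given by a decomposition \<open>G/Z = N1/Z \<times> N2/Z\<close>; the
  projection of \<open>h\<close> to \<open>N1/Z\<close> is trivial iff the image of \<open>h\<close> is contained in \<open>N2\<close>.
\<close>

definition shimura_axiom1 :: "('n::finite cmat) set \<Rightarrow> (2 cmat \<Rightarrow> 'n cmat) \<Rightarrow> bool" where
  "shimura_axiom1 G h \<longleftrightarrow>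
     has_hodge_types (\<lambda>c A. mat c ** A) (\<lambda>z w. conj_by (h (deligne_pt z w))) (Lie G)
       {(-1, 1), (0, 0), (1, -1)}"

definition shimura_axiom2 :: "('n::finite cmat) set \<Rightarrow> (2 cmat \<Rightarrow> 'n cmat) \<Rightarrow> bool" where
  "shimura_axiom2 G h \<longleftrightarrow>
     compact {Ad G g |g. g \<in> G \<and>
                Ad G (conj_by (h (deligne_pt \<i> (-\<i>))) (map_matrix cnj g)) = Ad G g}"

definition shimura_axiom3 :: "('n::finite cmat) set \<Rightarrow> (2 cmat \<Rightarrow> 'n cmat) \<Rightarrow> bool" where
  "shimura_axiom3 G h \<longleftrightarrow>
     (\<forall>N1 N2. alg_group \<rat> N1 \<and> alg_group \<rat> N2 \<and> normal N1 (mgroup G) \<and> normal N2 (mgroup G) \<and>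
        N1 \<inter> N2 = centralizer G G \<and> N1 <#>\<^bsub>mgroup G\<^esub> N2 = G \<and> h ` deligne_torus \<subseteq> N2
        \<longrightarrow> N1 = centralizer G G)"

text \<open>Elements of \<open>X\<close> are extensional functions on the Deligne torus, so that two of them are equal
  iff they are equal as homomorphisms.\<close>

definition shimura_datum :: "('n::finite cmat) set \<Rightarrow> (2 cmat \<Rightarrow> 'n cmat) set \<Rightarrow> bool" where
  "shimura_datum G X \<longleftrightarrow>
     alg_group \<rat> G \<and> connected_reductive G \<and>
     (\<exists>h. alg_hom \<real> deligne_torus G h \<and>
        X = {restrict (\<lambda>s. conj_by g (h s)) deligne_torus |g. g \<in> points \<real> G}) \<and>
     (\<forall>h\<in>X. shimura_axiom1 G h \<and> shimura_axiom2 G h \<and> shimura_axiom3 G h)"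

definition hodge_cochar :: "(2 cmat \<Rightarrow> 'n::finite cmat) \<Rightarrow> complex \<Rightarrow> 'n cmat" where
  "hodge_cochar h z = h (deligne_pt z 1)"


section \<open>Siegel Shimura data and symplectic embeddings\<close>

text \<open>The symplectic space is the space of rational vectors indexed by \<open>'v\<close> with the form of Gram
  matrix \<open>J\<close>; nondegeneracy forces the dimension to be even.\<close>

definition symplectic_form :: "rat ^ 'v ^ 'v::finite \<Rightarrow> bool" where
  "symplectic_form J \<longleftrightarrow> transpose J = - J \<and> invertible J"

definition bform :: "rat ^ 'v ^ 'v::finite \<Rightarrow> complex ^ 'v \<Rightarrow> complex ^ 'v \<Rightarrow> complex" where
  "bform J u v = (\<Sum>i\<in>UNIV. \<Sum>j\<in>UNIV. u $ i * of_rat (J $ i $ j) * v $ j)"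

definition GSp :: "rat ^ 'v ^ 'v::finite \<Rightarrow> ('v cmat) set" where
  "GSp J = {A. invertible A \<and>
     (\<exists>c. c \<noteq> 0 \<and> (\<forall>u v. bform J (A *v u) (A *v v) = c * bform J u v))}"

text \<open>\<open>\<epsilon>\<close> times the form is a polarization of the Hodge structure of weight \<open>-1\<close> given by \<open>h\<close>: it is a
  morphism to the Tate structure of weight \<open>-2\<close>, on which \<open>(z, w)\<close> acts as \<open>z w\<close>, and
  \<open>(u, v) \<mapsto> \<epsilon> J(u, h(i) v)\<close> is symmetric and positive definite on real vectors, where it is
  real-valued.\<close>

definition polarizes :: "real \<Rightarrow> rat ^ 'v ^ 'v::finite \<Rightarrow> (2 cmat \<Rightarrow> 'v cmat) \<Rightarrow> bool" where
  "polarizes \<epsilon> J h \<longleftrightarrow>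
     (\<forall>z w u v. z \<noteq> 0 \<and> w \<noteq> 0 \<longrightarrow>
        bform J (h (deligne_pt z w) *v u) (h (deligne_pt z w) *v v) = z * w * bform J u v) \<and>
     (\<forall>u v. bform J u (h (deligne_pt \<i> (-\<i>)) *v v) = bform J v (h (deligne_pt \<i> (-\<i>)) *v u)) \<and>
     (\<forall>u. u \<noteq> 0 \<and> (\<forall>i. u $ i \<in> \<real>) \<longrightarrow> 0 < \<epsilon> * Re (bform J u (h (deligne_pt \<i> (-\<i>)) *v u)))"

definition siegel_homs :: "rat ^ 'v ^ 'v::finite \<Rightarrow> (2 cmat \<Rightarrow> 'v cmat) set" where
  "siegel_homs J = {h \<in> extensional deligne_torus. alg_hom \<real> deligne_torus (GSp J) h \<and>
     has_hodge_types (*s) (\<lambda>z w v. h (deligne_pt z w) *v v) UNIV {(-1, 0), (0, -1)} \<and>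
     (polarizes 1 J h \<or> polarizes (-1) J h)}"

definition symplectic_embedding ::
  "('m::finite cmat) set \<Rightarrow> (2 cmat \<Rightarrow> 'm cmat) set \<Rightarrow> rat ^ 'v ^ 'v::finite \<Rightarrow>
     ('m cmat \<Rightarrow> 'v cmat) \<Rightarrow> bool" where
  "symplectic_embedding G X J \<psi> \<longleftrightarrow>
     alg_hom \<rat> G (GSp J) \<psi> \<and> inj_on \<psi> G \<and>
     (\<forall>h\<in>X. compose deligne_torus \<psi> h \<in> siegel_homs J)"

text \<open>The type argument carries the dimension of the symplectic space; as a premise with a free type
  variable it therefore says that an embedding into some Siegel datum exists.\<close>

definition of_hodge_type ::
  "'v::finite itself \<Rightarrow> ('m::finite cmat) set \<Rightarrow> (2 cmat \<Rightarrow> 'm cmat) set \<Rightarrow> bool" where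
  "of_hodge_type _ G X \<longleftrightarrow>
     (\<exists>(J :: rat ^ 'v ^ 'v) \<psi>. symplectic_form J \<and> symplectic_embedding G X J \<psi>)"


section \<open>The Hodge character\<close>

text \<open>The determinant of \<open>A\<close> on an \<open>A\<close>-stable subspace \<open>U\<close>, by the Leibniz formula in a basis of \<open>U\<close>.\<close>

definition det_on :: "(complex ^ 'v::finite) set \<Rightarrow> 'v cmat \<Rightarrow> complex" where
  "det_on U A = (let B = (SOME B. vec.independent B \<and> vec.span B = U) in
     \<Sum>p | p permutes B. of_int (sign p) * (\<Prod>b\<in>B. vec.representation B (A *v b) (p b)))"

text \<open>\<open>V10 m\<close> is the subspace \<open>V^{-1,0}\<close> on which the cocharacter \<open>m\<close> acts by the standard
  character.\<close>

definition V10 :: "(complex \<Rightarrow> 'v::finite cmat) \<Rightarrow> (complex ^ 'v) set" where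
  "V10 m = {v. \<forall>z. z \<noteq> 0 \<longrightarrow> m z *v v = z *s v}"

definition cent_cochar :: "('n::finite cmat) set \<Rightarrow> (complex \<Rightarrow> 'n cmat) \<Rightarrow> ('n cmat) set" where
  "cent_cochar G m = centralizer G (m ` (- {0}))"

definition siegel_hodge_character ::
  "rat ^ 'v ^ 'v::finite \<Rightarrow> (complex \<Rightarrow> 'v cmat) \<Rightarrow> 'v cmat \<Rightarrow> complex" where
  "siegel_hodge_character J m = (\<lambda>A \<in> cent_cochar (GSp J) m. inverse (det_on (V10 m) A))"

definition hodge_character ::
  "('m::finite cmat) set \<Rightarrow> rat ^ 'v ^ 'v::finite \<Rightarrow> ('m cmat \<Rightarrow> 'v cmat) \<Rightarrow>
     (complex \<Rightarrow> 'm cmat) \<Rightarrow> 'm cmat \<Rightarrow> complex" where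
  "hodge_character G J \<psi> \<mu> =
     compose (cent_cochar G \<mu>) (siegel_hodge_character J (\<psi> \<circ> \<mu>)) \<psi>"

end

theory Submission
  imports Defs
begin

text \<open>
  Write \<open>V\<close> for the symplectic representation and \<open>(l, l') = tr (dl dl')\<close> for the trace form of \<open>V\<close> on
  cocharacters of \<open>T\<close>, where \<open>dl\<close> is the derivative of \<open>\<psi> \<circ> l\<close> at 1. Since \<open>\<mu>\<close> acts on \<open>V\<close> with
  weights 0 and 1, \<open>d\<mu>\<close> is the projection to \<open>V\<^sup>-\<^sup>1\<^sup>,\<^sup>0\<close>, so the Hodge character pairs with \<open>l\<close> to
  \<open>- (\<mu>, l)\<close>. The form is invariant under the Weyl and Galois groups because \<open>\<psi>\<close> is defined over the
  rationals. Hence for a coroot \<open>b\<close> of \<open>a\<close> one has \<open>2 (l, b) = \<langle>a, l\<rangle> (b, b)\<close>, and the ratio in the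
  definition of quasi-constancy is \<open>\<langle>a, \<sigma>\<^sup>-\<^sup>1 \<mu>\<rangle> / \<langle>a, \<mu>\<rangle>\<close>. Both numbers are in \<open>{-1, 0, 1}\<close>, because
  each of \<open>\<mu>\<close> and \<open>\<sigma>\<^sup>-\<^sup>1 \<mu>\<close>, as well as its reflection in \<open>a\<close>, has weights 0 and 1 on the faithful
  representation \<open>V\<close>.
\<close>

section \<open>The field of algebraic numbers\<close>

text \<open>The obstacle is that a Galois element acts only on algebraic numbers and is in general
  not continuous, so it cannot be applied to a derivative. The twist is therefore carried out on
  determinants: on algebraic points the determinant of a cocharacter on the image of a projection is
  z to an integer power, and the exponent survives any field automorphism. Only after \<sigma> has
  been moved from \<open>b\<close> to \<mu> is that exponent read as a trace, by differentiating at
  1. Statements obtained on algebraic points extend to all nonzero complex numbers because a Laurent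
  polynomial is determined by infinitely many values. The bound on \<langle>a, x\<rangle> avoids
  decomposing V into weight spaces of T. A cocharacter with weights 0 and 1 is determined by its
  value at any single z other than 1. If \<langle>a, x\<rangle> were outside {-1, 0, 1}, some root
  of unity z different from 1 would give x and its reflection the same value; the reflection would
  then fix x, and faithfulness would make \<open>b\<close> trivial, against \<langle>a, b\<rangle> =
  2.\<close>

interpretation rat_span: vector_space "\<lambda>(q::rat) (z::complex). of_rat q * z"
  by unfold_locales (simp_all add: algebra_simps of_rat_add of_rat_mult)

text \<open>Among \<open>card S + 1\<close> powers of \<open>w\<close> there is a rational linear
  relation, which is a polynomial with root \<open>w\<close>. Dependence concerns the set of powers,
  so two equal powers are a separate case, with the polynomial x^i - x^j.\<close>

lemma algebraic_if_powers_in_span: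
  fixes w :: complex
  assumes "finite S" and "\<And>n. w ^ n \<in> rat_span.span S"
  shows "algebraic w"
proof (cases "inj_on (\<lambda>i. w ^ i) {..card S}")
  case False
  then obtain i j where ij: "i \<noteq> j" "w ^ i = w ^ j"
    by (auto simp: inj_on_def)
  define p :: "complex poly" where "p = monom 1 i - monom 1 j"
  have "coeff p i \<noteq> 0"
    using ij(1) by (simp add: p_def)
  then have "p \<noteq> 0"
    by auto
  moreover have "coeff p k \<in> \<int>" for k
    by (auto simp: p_def)
  moreover have "poly p w = 0"
    using ij by (simp add: p_def poly_monom)
  ultimately show ?thesis
    by (intro algebraicI)
next
  case True
  let ?B = "(\<lambda>i. w ^ i) ` {..card S}"
  have "card ?B = Suc (card S)"
    using card_image[OF True] by simp
  then have "rat_span.dependent ?B"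
    using rat_span.independent_span_bound[of S ?B] assms by auto
  then obtain u where u: "(\<Sum>v\<in>?B. of_rat (u v) * v) = 0" "\<exists>v\<in>?B. u v \<noteq> 0"
    using rat_span.dependent_finite[of ?B] by auto
  define p :: "complex poly" where "p = (\<Sum>i\<le>card S. monom (of_rat (u (w ^ i))) i)"
  have coeff_p: "coeff p k = (if k \<le> card S then of_rat (u (w ^ k)) else 0)" for k
    by (simp add: p_def coeff_sum)
  have "p \<noteq> 0"
  proof -
    obtain i where "i \<le> card S" "u (w ^ i) \<noteq> 0"
      using u(2) by auto
    then have "coeff p i \<noteq> 0"
      by (simp add: coeff_p)
    then show ?thesis
      by auto
  qed
  moreover have "\<forall>k. coeff p k \<in> \<rat>"
    by (auto simp: coeff_p)
  moreover have "poly p w = 0"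
    using u(1) by (simp add: p_def poly_sum poly_monom sum.reindex[OF True] mult.commute)
  ultimately show ?thesis
    unfolding algebraic_altdef by blast
qed

text \<open>Solve the polynomial relation for its top power; multiplying by a power of
  \<open>x\<close> lowers every larger exponent, and strong induction finishes.\<close>

lemma power_in_span_lower_powers:
  fixes x :: complex
  assumes "algebraic x"
  obtains d where "\<And>n. x ^ n \<in> rat_span.span ((\<lambda>i. x ^ i) ` {..<d})"
proof -
  obtain p where p: "\<forall>i. coeff p i \<in> \<rat>" "p \<noteq> 0" "poly p x = 0"
    using assms unfolding algebraic_altdef by blast
  define d where "d = degree p"
  let ?V = "rat_span.span ((\<lambda>i. x ^ i) ` {..<d})"
  have lc: "lead_coeff p \<noteq> 0"
    using p(2) by simp
  define c where "c i = - coeff p i / lead_coeff p" for i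
  have cR: "c i \<in> \<rat>" for i
    unfolding c_def using p(1) by (intro Rats_divide Rats_minus_iff[THEN iffD2]) auto
  have top: "x ^ d = (\<Sum>i<d. c i * x ^ i)"
  proof -
    have "(\<Sum>i<d. coeff p i * x ^ i) + lead_coeff p * x ^ d = 0"
      using p(3) unfolding poly_altdef d_def by (simp add: lessThan_Suc_atMost[symmetric])
    then have "lead_coeff p * x ^ d = - (\<Sum>i<d. coeff p i * x ^ i)"
      by (simp add: eq_neg_iff_add_eq_0 add.commute)
    then have "x ^ d = - (\<Sum>i<d. coeff p i * x ^ i) / lead_coeff p"
      using lc by (simp add: field_simps)
    also have "\<dots> = (\<Sum>i<d. c i * x ^ i)"
      by (simp add: c_def sum_divide_distrib sum_negf)
    finally show ?thesis .
  qed
  have "x ^ n \<in> ?V" for n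
  proof (induction n rule: less_induct)
    case (less n)
    show ?case
    proof (cases "n < d")
      case True
      then show ?thesis
        by (intro rat_span.span_base) auto
    next
      case False
      then have "x ^ n = (\<Sum>i<d. c i * x ^ (n - d + i))"
        using arg_cong[OF top, of "\<lambda>y. x ^ (n - d) * y"]
        by (simp add: sum_distrib_left power_add[symmetric] mult.left_commute)
      also have "\<dots> \<in> ?V"
      proof (intro rat_span.span_sum)
        fix i assume "i \<in> {..<d}"
        then have "x ^ (n - d + i) \<in> ?V"
          using False by (intro less) auto
        moreover obtain q where "c i = of_rat q"
          using cR Rats_cases by blast
        ultimately show "c i * x ^ (n - d + i) \<in> ?V"
          using rat_span.span_scale[of "x ^ (n - d + i)" _ q] by simp
      qed
      finally show ?thesis .
    qed
  qed
  then show ?thesis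
    using that by blast
qed

lemma span_mult:
  assumes "u \<in> rat_span.span A" "v \<in> rat_span.span B"
  shows "u * v \<in> rat_span.span ((\<lambda>(a, b). a * b) ` (A \<times> B))"
proof -
  let ?V = "rat_span.span ((\<lambda>(a, b). a * b) ` (A \<times> B))"
  have base: "a * v \<in> ?V" if "a \<in> A" for a
    using assms(2)
  proof (induction rule: rat_span.span_induct_alt)
    case base
    then show ?case by (simp add: rat_span.span_zero)
  next
    case (step q b y)
    have "a * b \<in> ?V"
      using that step(1) by (intro rat_span.span_base) auto
    from rat_span.span_add[OF rat_span.span_scale[OF this, of q] step(2)]
    show ?case
      by (simp add: algebra_simps)
  qed
  show ?thesis
    using assms(1)
  proof (induction rule: rat_span.span_induct_alt)
    case base
    then show ?case by (simp add: rat_span.span_zero)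
  next
    case (step q a y)
    from rat_span.span_add[OF rat_span.span_scale[OF base[OF step(1)], of q] step(2)]
    show ?case
      by (simp add: algebra_simps)
  qed
qed

text \<open>The finitely many products of low powers of \<open>x\<close> and of \<open>y\<close>
  span a rational space that contains all powers of both the sum and the product.\<close>

lemma
  fixes x y :: complex
  assumes "algebraic x" "algebraic y"
  shows algebraic_add: "algebraic (x + y)" and algebraic_mult: "algebraic (x * y)"
proof -
  obtain d where d: "\<And>n. x ^ n \<in> rat_span.span ((\<lambda>i. x ^ i) ` {..<d})"
    using power_in_span_lower_powers[OF assms(1)] by blast
  obtain e where e: "\<And>n. y ^ n \<in> rat_span.span ((\<lambda>i. y ^ i) ` {..<e})"
    using power_in_span_lower_powers[OF assms(2)] by blast
  define S where "S = (\<lambda>(a, b). a * b) ` ((\<lambda>i. x ^ i) ` {..<d} \<times> (\<lambda>i. y ^ i) ` {..<e})"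
  have fin: "finite S"
    by (simp add: S_def)
  have prod: "x ^ m * y ^ n \<in> rat_span.span S" for m n
    unfolding S_def by (rule span_mult[OF d e])
  show "algebraic (x * y)"
    using fin prod by (intro algebraic_if_powers_in_span[of S]) (auto simp: power_mult_distrib)
  have "(x + y) ^ n \<in> rat_span.span S" for n
    unfolding binomial_ring
  proof (intro rat_span.span_sum)
    fix k
    show "of_nat (n choose k) * x ^ k * y ^ (n - k) \<in> rat_span.span S"
      using rat_span.span_scale[OF prod[of k "n - k"], of "of_nat (n choose k)"]
      by (simp add: mult.assoc)
  qed
  then show "algebraic (x + y)"
    using fin by (intro algebraic_if_powers_in_span[of S])
qed

text \<open>Negatives come from the rational number -1, and \<open>inverse 0 = 0\<close> lets the
  last clause range over all of \<open>K\<close>. One notion covers \<open>\<rat>\<close>,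
  \<open>Qbar\<close> and \<open>UNIV\<close>.\<close>

definition subfield_C :: "complex set \<Rightarrow> bool" where
  "subfield_C K \<longleftrightarrow> \<rat> \<subseteq> K \<and> (\<forall>x\<in>K. \<forall>y\<in>K. x + y \<in> K \<and> x * y \<in> K) \<and> (\<forall>x\<in>K. inverse x \<in> K)"

lemma subfield_C_Rats: "subfield_C \<rat>"
  by (auto simp: subfield_C_def)

lemma subfield_C_Qbar: "subfield_C Qbar"
  by (auto simp: subfield_C_def Qbar_def algebraic_add algebraic_mult algebraic_inverse rat_imp_algebraic)

lemma Qbar_infinite: "infinite (Qbar - {0})"
proof
  assume "finite (Qbar - {0})"
  then have "finite (of_nat ` {0<..} :: complex set)"
    by (rule rev_finite_subset) (auto simp: Qbar_def)
  then have "finite {0::nat<..}"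
    by (rule finite_imageD) (auto simp: inj_on_def)
  then show False
    using infinite_Ioi by blast
qed

context
  fixes K :: "complex set"
  assumes K: "subfield_C K"
begin

lemma subfield_C_rat: "q \<in> \<rat> \<Longrightarrow> q \<in> K"
  using K by (auto simp: subfield_C_def)

lemma subfield_C_of_int: "of_int q \<in> K"
  by (rule subfield_C_rat) simp

lemma subfield_C_0: "0 \<in> K" and subfield_C_1: "1 \<in> K"
  by (auto intro: subfield_C_rat)

lemma subfield_C_add: "x \<in> K \<Longrightarrow> y \<in> K \<Longrightarrow> x + y \<in> K"
  and subfield_C_mult: "x \<in> K \<Longrightarrow> y \<in> K \<Longrightarrow> x * y \<in> K"
  and subfield_C_inverse: "x \<in> K \<Longrightarrow> inverse x \<in> K"
  using K by (auto simp: subfield_C_def)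

lemma subfield_C_minus: "x \<in> K \<Longrightarrow> - x \<in> K"
  using subfield_C_mult[OF subfield_C_of_int[of "-1"], of x] by simp

lemma subfield_C_diff: "x \<in> K \<Longrightarrow> y \<in> K \<Longrightarrow> x - y \<in> K"
  using subfield_C_add[OF _ subfield_C_minus, of x y] by simp

lemma subfield_C_divide: "x \<in> K \<Longrightarrow> y \<in> K \<Longrightarrow> x / y \<in> K"
  by (simp add: divide_inverse subfield_C_mult subfield_C_inverse)

lemma subfield_C_power: "x \<in> K \<Longrightarrow> x ^ n \<in> K"
  by (induction n) (auto intro: subfield_C_1 subfield_C_mult)

lemma subfield_C_sum: "(\<And>i. i \<in> A \<Longrightarrow> f i \<in> K) \<Longrightarrow> sum f A \<in> K"
  by (induction A rule: infinite_finite_induct) (auto intro: subfield_C_0 subfield_C_add)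

lemma subfield_C_poly: "(\<forall>i. coeff q i \<in> K) \<Longrightarrow> x \<in> K \<Longrightarrow> poly q x \<in> K"
  unfolding poly_altdef by (intro subfield_C_sum subfield_C_mult subfield_C_power) auto

end


section \<open>Matrices and regular functions\<close>

lemma
  fixes A :: "'n::finite cmat"
  assumes "invertible A"
  shows matrix_inv_right: "A ** matrix_inv A = mat 1"
    and matrix_inv_left: "matrix_inv A ** A = mat 1"
proof -
  from assms have "\<exists>B. A ** B = mat 1 \<and> B ** A = mat 1"
    by (simp add: invertible_def)
  then have "A ** matrix_inv A = mat 1 \<and> matrix_inv A ** A = mat 1"
    unfolding matrix_inv_def by (rule someI_ex)
  then show "A ** matrix_inv A = mat 1" "matrix_inv A ** A = mat 1"
    by auto
qed

lemma matrix_inv_unique: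
  fixes A :: "'n::finite cmat"
  assumes "A ** B = mat 1"
  shows "matrix_inv A = B"
proof -
  have "invertible A"
    using assms invertible_right_inverse by blast
  then have "matrix_inv A ** (A ** B) = B"
    by (simp add: matrix_mul_assoc matrix_inv_left)
  then show ?thesis
    by (simp add: assms)
qed

lemma invertible_matrix_inv: "invertible (A :: 'n::finite cmat) \<Longrightarrow> invertible (matrix_inv A)"
  using matrix_inv_left matrix_inv_right invertible_def by blast

text \<open>Cramer's rule for the j-th column of the identity. It shows that inversion is given by
  regular functions with rational coefficients.\<close>

lemma matrix_inv_entry:
  fixes A :: "'n::finite cmat"
  assumes "invertible A"
  shows "matrix_inv A $ i $ j = det (\<chi> a b. if b = i then axis j 1 $ a else A $ a $ b) / det A"
proof -
  have "A *v (matrix_inv A *v axis j 1) = axis j 1"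
    by (simp add: matrix_vector_mul_assoc matrix_inv_right[OF assms])
  then have "det ((\<chi> a b. if b = i then axis j 1 $ a else A $ a $ b) :: 'n cmat) = (matrix_inv A *v axis j 1) $ i * det A"
    using cramer_lemma[where k = i and A = A and x = "matrix_inv A *v axis j 1"]
    by (simp only: \<open>A *v (matrix_inv A *v axis j 1) = axis j 1\<close>)
  moreover have "(matrix_inv A *v axis j 1) $ i = matrix_inv A $ i $ j"
    by (simp add: matrix_vector_mult_def axis_def if_distrib[of "(*) _"] cong: if_cong)
  moreover have "det A \<noteq> 0"
    using assms invertible_det_nz by blast
  ultimately show ?thesis
    by simp
qed

lemma matrix_mult_entry: "(A ** B) $ i $ j = (\<Sum>k\<in>UNIV. A $ i $ k * B $ k $ j)"
  by (simp add: matrix_matrix_mult_def)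

definition entries_in :: "complex set \<Rightarrow> 'n::finite cmat \<Rightarrow> bool" where
  "entries_in K A \<longleftrightarrow> (\<forall>i j. A $ i $ j \<in> K)"

lemma entries_inD: "entries_in K A \<Longrightarrow> A $ i $ j \<in> K"
  by (simp add: entries_in_def)

context
  fixes K :: "complex set"
  assumes K: "subfield_C K"
begin

lemma entries_in_mult: "entries_in K A \<Longrightarrow> entries_in K B \<Longrightarrow> entries_in K (A ** B)"
  using K by (auto simp: entries_in_def matrix_mult_entry intro!: subfield_C_sum subfield_C_mult)

lemma entries_in_add: "entries_in K A \<Longrightarrow> entries_in K B \<Longrightarrow> entries_in K (A + B)"
  using K by (auto simp: entries_in_def intro!: subfield_C_add)

lemma entries_in_diff: "entries_in K A \<Longrightarrow> entries_in K B \<Longrightarrow> entries_in K (A - B)"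
  using K by (auto simp: entries_in_def intro!: subfield_C_diff)

lemma entries_in_mat: "c \<in> K \<Longrightarrow> entries_in K (mat c)"
  using K by (auto simp: entries_in_def mat_def intro!: subfield_C_0)

lemma poly_fun_sum:
  "(\<And>i. i \<in> I \<Longrightarrow> f i \<in> poly_fun K) \<Longrightarrow> (\<lambda>A. \<Sum>i\<in>I. f i A) \<in> poly_fun K"
  using K by (induction I rule: infinite_finite_induct) (auto intro: poly_fun.intros subfield_C_0)

lemma poly_fun_prod:
  "(\<And>i. i \<in> I \<Longrightarrow> f i \<in> poly_fun K) \<Longrightarrow> (\<lambda>A. \<Prod>i\<in>I. f i A) \<in> poly_fun K"
  using K by (induction I rule: infinite_finite_induct) (auto intro: poly_fun.intros subfield_C_1)

lemma poly_fun_det_comp: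
  fixes M :: "'n::finite cmat \<Rightarrow> 'k::finite cmat"
  assumes "\<And>i j. (\<lambda>A. M A $ i $ j) \<in> poly_fun K"
  shows "(\<lambda>A. det (M A)) \<in> poly_fun K"
  unfolding det_def
  by (intro poly_fun_sum poly_fun.mult poly_fun_prod assms poly_fun.const subfield_C_of_int[OF K])

lemma poly_fun_det: "det \<in> poly_fun K"
  using poly_fun_det_comp[of "\<lambda>A. A"] by (simp add: poly_fun.coord)

lemma poly_fun_in_field:
  assumes "p \<in> poly_fun K" "entries_in K A"
  shows "p A \<in> K"
  using assms(1)
  by induction (use assms(2) K in \<open>auto intro: subfield_C_add subfield_C_mult entries_inD\<close>)

lemma det_in_field: "entries_in K A \<Longrightarrow> det A \<in> K"
  using poly_fun_in_field poly_fun_det by blast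

lemma entries_in_matrix_inv:
  assumes "invertible A" "entries_in K A"
  shows "entries_in K (matrix_inv A)"
  unfolding entries_in_def matrix_inv_entry[OF assms(1)]
  using assms(2) K
  by (auto simp: entries_in_def axis_def intro!: subfield_C_divide det_in_field intro: subfield_C_0 subfield_C_1)

lemma regular_on_in_field:
  assumes "regular_on K G f" "A \<in> G" "entries_in K A"
  shows "f A \<in> K"
  using assms poly_fun_in_field det_in_field K
  by (fastforce simp: regular_on_def intro: subfield_C_divide subfield_C_power)

lemma regular_on_poly_fun: "p \<in> poly_fun K \<Longrightarrow> regular_on K G p"
  unfolding regular_on_def by (rule bexI[of _ p], rule exI[of _ 0]) auto

lemma regular_on_const: "c \<in> K \<Longrightarrow> regular_on K G (\<lambda>g. c)"
  by (intro regular_on_poly_fun poly_fun.const)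

lemma regular_on_inverse_det: "regular_on K G (\<lambda>g. 1 / det g)"
  unfolding regular_on_def
  by (rule bexI[of _ "\<lambda>g. 1"], rule exI[of _ 1]) (auto intro: poly_fun.const subfield_C_1[OF K])

lemma poly_fun_power: "p \<in> poly_fun K \<Longrightarrow> (\<lambda>A. p A ^ k) \<in> poly_fun K"
  by (induction k) (auto intro: poly_fun.intros subfield_C_1[OF K])

lemma regular_on_mult:
  assumes "regular_on K G f" "regular_on K G f'"
  shows "regular_on K G (\<lambda>g. f g * f' g)"
proof -
  obtain p k p' k' where "p \<in> poly_fun K" "p' \<in> poly_fun K"
    and f: "\<forall>g\<in>G. f g = p g / det g ^ k" "\<forall>g\<in>G. f' g = p' g / det g ^ k'"
    using assms unfolding regular_on_def by blast
  then have "(\<lambda>g. p g * p' g) \<in> poly_fun K"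
    by (auto intro: poly_fun.mult)
  moreover have "\<forall>g\<in>G. f g * f' g = (p g * p' g) / det g ^ (k + k')"
    using f by (simp add: power_add)
  ultimately show ?thesis
    unfolding regular_on_def by (intro bexI[of _ "\<lambda>g. p g * p' g"]) blast+
qed

lemma regular_on_add:
  assumes inv: "\<And>g. g \<in> G \<Longrightarrow> invertible g"
    and "regular_on K G f" "regular_on K G f'"
  shows "regular_on K G (\<lambda>g. f g + f' g)"
proof -
  obtain p k p' k' where p: "p \<in> poly_fun K" "p' \<in> poly_fun K"
    and f: "\<forall>g\<in>G. f g = p g / det g ^ k" "\<forall>g\<in>G. f' g = p' g / det g ^ k'"
    using assms unfolding regular_on_def by blast
  define q where "q g = p g * det g ^ k' + p' g * det g ^ k" for g
  have "q \<in> poly_fun K"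
    unfolding q_def using p by (intro poly_fun.add poly_fun.mult poly_fun_power poly_fun_det)
  moreover have "f g + f' g = q g / det g ^ (k + k')" if "g \<in> G" for g
  proof -
    have "det g \<noteq> 0"
      using inv[OF that] invertible_det_nz by blast
    then show ?thesis
      using f that by (simp add: q_def power_add field_simps)
  qed
  ultimately show ?thesis
    unfolding regular_on_def by blast
qed

lemma regular_on_sum:
  assumes "\<And>g. g \<in> G \<Longrightarrow> invertible g"
    and "\<And>i. i \<in> I \<Longrightarrow> regular_on K G (f i)"
  shows "regular_on K G (\<lambda>g. \<Sum>i\<in>I. f i g)"
  using assms(2)
  by (induction I rule: infinite_finite_induct)
    (auto intro: regular_on_const subfield_C_0[OF K] regular_on_add[OF assms(1)])

lemma regular_on_prod:
  assumes "\<And>i. i \<in> I \<Longrightarrow> regular_on K G (f i)"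
  shows "regular_on K G (\<lambda>g. \<Prod>i\<in>I. f i g)"
  using assms
  by (induction I rule: infinite_finite_induct)
    (auto intro: regular_on_const subfield_C_1[OF K] regular_on_mult)

lemma regular_on_det_comp:
  assumes "\<And>g. g \<in> G \<Longrightarrow> invertible g"
    and "\<And>i j. regular_on K G (\<lambda>g. M g $ i $ j)"
  shows "regular_on K G (\<lambda>g. det (M g))"
  unfolding det_def
  by (intro regular_on_sum regular_on_mult regular_on_prod regular_on_const assms subfield_C_of_int[OF K])

text \<open>By Cramer's rule a polynomial in the entries of the inverse is regular, and the
  denominator \<open>det (matrix_inv g) ^ k\<close> turns into the factor
  \<open>det g ^ k\<close>.\<close>

lemma regular_on_matrix_inv:
  fixes f :: "'n::finite cmat \<Rightarrow> complex"
  assumes inv: "\<And>g. g \<in> G \<Longrightarrow> invertible g"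
    and G: "\<And>g. g \<in> G \<Longrightarrow> matrix_inv g \<in> G"
    and f: "regular_on K G f"
  shows "regular_on K G (\<lambda>g. f (matrix_inv g))"
proof -
  obtain p k where p: "p \<in> poly_fun K" and f: "\<forall>g\<in>G. f g = p g / det g ^ k"
    using f unfolding regular_on_def by blast
  have coord: "regular_on K G (\<lambda>g. matrix_inv g $ i $ j)" for i j
  proof -
    have "regular_on K G (\<lambda>g. det (\<chi> a b. if b = i then axis j 1 $ a else g $ a $ b) * (1 / det g))"
    proof (intro regular_on_mult regular_on_inverse_det regular_on_det_comp inv)
      fix a b
      show "regular_on K G (\<lambda>g. (\<chi> a b. if b = i then axis j 1 $ a else g $ a $ b) $ a $ b)"
        by (cases "b = i") (auto simp: axis_def
            intro!: regular_on_poly_fun poly_fun.coord poly_fun.const subfield_C_0[OF K] subfield_C_1[OF K])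
    qed
    then show ?thesis
      unfolding regular_on_def using matrix_inv_entry[OF inv] by simp
  qed
  have "regular_on K G (\<lambda>g. p (matrix_inv g))"
    using p
    by induction (auto intro: coord regular_on_const regular_on_add[OF inv] regular_on_mult)
  moreover have "regular_on K G (\<lambda>g. det g ^ k)"
    by (intro regular_on_poly_fun poly_fun_power poly_fun_det)
  ultimately have "regular_on K G (\<lambda>g. p (matrix_inv g) * det g ^ k)"
    by (rule regular_on_mult)
  moreover have "f (matrix_inv g) = p (matrix_inv g) * det g ^ k" if "g \<in> G" for g
  proof -
    have "det g * det (matrix_inv g) = 1"
      using arg_cong[OF matrix_inv_right[OF inv[OF that]], of det] by (simp add: det_mul)
    then have "det g ^ k * det (matrix_inv g) ^ k = 1"
      by (metis power_mult_distrib power_one)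
    then have "1 / det (matrix_inv g) ^ k = det g ^ k"
      by (metis mult_cancel_right1 mult.commute nonzero_eq_divide_eq zero_neq_one mult_zero_right)
    then show ?thesis
      using f G[OF that] by (metis times_divide_eq_right mult.right_neutral)
  qed
  ultimately show ?thesis
    unfolding regular_on_def by simp
qed

end

lemma poly_fun_mono:
  assumes "K \<subseteq> L"
  shows "(poly_fun K :: ('n::finite cmat \<Rightarrow> complex) set) \<subseteq> poly_fun L"
proof
  fix p :: "'n cmat \<Rightarrow> complex" assume "p \<in> poly_fun K"
  then show "p \<in> poly_fun L"
    by induction (use assms in \<open>auto intro: poly_fun.intros\<close>)
qed

lemma regular_on_mono: "regular_on K G f \<Longrightarrow> K \<subseteq> L \<Longrightarrow> H \<subseteq> G \<Longrightarrow> regular_on L H f"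
  unfolding regular_on_def using poly_fun_mono by blast


section \<open>The Galois action\<close>

lemma map_matrix_nth [simp]: "map_matrix f A $ i $ j = f (A $ i $ j)"
  by (simp add: map_matrix_def)

text \<open>Membership in \<open>Gal_Qbar\<close> constrains \<open>s\<close> on \<open>Qbar\<close>
  alone, which is why the laws below carry hypotheses of algebraicity.\<close>

locale galois =
  fixes s :: "complex \<Rightarrow> complex"
  assumes s: "s \<in> Gal_Qbar"
begin

lemma bij: "bij_betw s Qbar Qbar"
  and add: "x \<in> Qbar \<Longrightarrow> y \<in> Qbar \<Longrightarrow> s (x + y) = s x + s y"
  and mult: "x \<in> Qbar \<Longrightarrow> y \<in> Qbar \<Longrightarrow> s (x * y) = s x * s y"
  and rat: "q \<in> \<rat> \<Longrightarrow> s q = q"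
  using s by (auto simp: Gal_Qbar_def)

lemma closed: "x \<in> Qbar \<Longrightarrow> s x \<in> Qbar"
  using bij by (auto simp: bij_betw_def)

lemma zero [simp]: "s 0 = 0" and one [simp]: "s 1 = 1" and of_int [simp]: "s (of_int k) = of_int k"
  by (auto intro: rat)

lemma eq_iff: "x \<in> Qbar \<Longrightarrow> y \<in> Qbar \<Longrightarrow> s x = s y \<longleftrightarrow> x = y"
  using bij by (auto simp: bij_betw_def inj_on_def)

lemmas Qbar_closed =
  subfield_C_0[OF subfield_C_Qbar] subfield_C_1[OF subfield_C_Qbar]
  subfield_C_add[OF subfield_C_Qbar] subfield_C_mult[OF subfield_C_Qbar]
  subfield_C_inverse[OF subfield_C_Qbar] subfield_C_power[OF subfield_C_Qbar]
  subfield_C_sum[OF subfield_C_Qbar] subfield_C_diff[OF subfield_C_Qbar]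
  subfield_C_divide[OF subfield_C_Qbar]

lemma eq_0_iff: "x \<in> Qbar \<Longrightarrow> s x = 0 \<longleftrightarrow> x = 0"
  using eq_iff[of x 0] Qbar_closed by simp

lemma diff: "x \<in> Qbar \<Longrightarrow> y \<in> Qbar \<Longrightarrow> s (x - y) = s x - s y"
  using add[of "x - y" y] Qbar_closed by simp

lemma inverse: "x \<in> Qbar \<Longrightarrow> s (inverse x) = inverse (s x)"
  using mult[of x "inverse x"] Qbar_closed
  by (cases "x = 0") (auto intro!: inverse_unique[symmetric])

lemma divide: "x \<in> Qbar \<Longrightarrow> y \<in> Qbar \<Longrightarrow> s (x / y) = s x / s y"
  by (simp add: divide_inverse mult inverse Qbar_closed)

lemma power: "x \<in> Qbar \<Longrightarrow> s (x ^ n) = s x ^ n"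
  by (induction n) (auto simp: mult Qbar_closed)

lemma sum: "(\<And>i. i \<in> A \<Longrightarrow> f i \<in> Qbar) \<Longrightarrow> s (sum f A) = (\<Sum>i\<in>A. s (f i))"
  by (induction A rule: infinite_finite_induct) (auto simp: add Qbar_closed)

lemma power_int: "x \<in> Qbar \<Longrightarrow> s (x powi k) = s x powi k"
  by (auto simp: power_int_def power inverse Qbar_closed)

lemma poly:
  assumes "\<forall>i. coeff q i \<in> Qbar" "x \<in> Qbar"
  shows "s (poly q x) = poly (map_poly s q) (s x)"
proof -
  have c: "coeff (map_poly s q) i = s (coeff q i)" for i
    by (simp add: coeff_map_poly)
  have "degree (map_poly s q) \<le> degree q"
    by (rule map_poly_degree_leq)
  then have "poly (map_poly s q) (s x) = (\<Sum>i\<le>degree q. s (coeff q i) * s x ^ i)"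
    unfolding poly_altdef c[symmetric]
    by (intro sum.mono_neutral_left) (auto simp: coeff_eq_0)
  also have "\<dots> = s (poly q x)"
    using assms by (simp add: poly_altdef sum mult power Qbar_closed)
  finally show ?thesis ..
qed

text \<open>The coefficients are rational, hence fixed by \<open>s\<close>. All later uses of
  definition over the rationals, for G, T and \<psi>, go back to this.\<close>

lemma poly_fun_equivariant:
  assumes "p \<in> poly_fun \<rat>" "entries_in Qbar A"
  shows "p (map_matrix s A) = s (p A)"
  using assms(1)
proof induction
  case (mult p q)
  then show ?case
    using assms(2) poly_fun_in_field[OF subfield_C_Qbar, of _ A] poly_fun_mono[of \<rat> Qbar]
      subfield_C_rat[OF subfield_C_Qbar] by (subst galois.mult[OF galois_axioms]) (auto simp: subset_iff)
next
  case (add p q)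
  then show ?case
    using assms(2) poly_fun_in_field[OF subfield_C_Qbar, of _ A] poly_fun_mono[of \<rat> Qbar]
      subfield_C_rat[OF subfield_C_Qbar] by (subst galois.add[OF galois_axioms]) (auto simp: subset_iff)
qed (use assms(2) in \<open>auto simp: rat\<close>)

lemma det_equivariant: "entries_in Qbar A \<Longrightarrow> det (map_matrix s A) = s (det A)"
  by (rule poly_fun_equivariant[OF poly_fun_det[OF subfield_C_Rats]])

lemma invertible_map: "entries_in Qbar A \<Longrightarrow> invertible A \<Longrightarrow> invertible (map_matrix s A)"
  using det_equivariant eq_0_iff det_in_field[OF subfield_C_Qbar] invertible_det_nz by metis

lemma regular_on_equivariant:
  assumes "regular_on \<rat> G f" "A \<in> G" "map_matrix s A \<in> G" "entries_in Qbar A"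
  shows "f (map_matrix s A) = s (f A)"
proof -
  obtain p k where p: "p \<in> poly_fun \<rat>" "\<forall>g\<in>G. f g = p g / det g ^ k"
    using assms unfolding regular_on_def by blast
  have "p \<in> poly_fun Qbar"
    using p(1) poly_fun_mono subfield_C_rat[OF subfield_C_Qbar] by blast
  then have "p A \<in> Qbar" "det A \<in> Qbar"
    using assms(4) poly_fun_in_field det_in_field subfield_C_Qbar by blast+
  then show ?thesis
    using p assms by (simp add: poly_fun_equivariant det_equivariant divide power Qbar_closed)
qed

lemma map_matrix_mult:
  "entries_in Qbar A \<Longrightarrow> entries_in Qbar B \<Longrightarrow> map_matrix s (A ** B) = map_matrix s A ** map_matrix s B"
  by (simp add: vec_eq_iff matrix_mult_entry entries_in_def sum mult Qbar_closed)

lemma map_matrix_add: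
  "entries_in Qbar A \<Longrightarrow> entries_in Qbar B \<Longrightarrow> map_matrix s (A + B) = map_matrix s A + map_matrix s B"
  by (simp add: vec_eq_iff entries_in_def add)

lemma map_matrix_diff:
  "entries_in Qbar A \<Longrightarrow> entries_in Qbar B \<Longrightarrow> map_matrix s (A - B) = map_matrix s A - map_matrix s B"
  by (simp add: vec_eq_iff entries_in_def diff)

lemma map_matrix_mat: "map_matrix s (mat c) = mat (s c)"
  by (simp add: vec_eq_iff mat_def)

lemma entries_in_map: "entries_in Qbar A \<Longrightarrow> entries_in Qbar (map_matrix s A)"
  by (simp add: entries_in_def closed)

lemma zariski_closed_stable:
  assumes "zariski_closed \<rat> G" "A \<in> G" "entries_in Qbar A"
  shows "map_matrix s A \<in> G"
proof -
  obtain F where F: "F \<subseteq> poly_fun \<rat>" "G = {A. invertible A \<and> (\<forall>f\<in>F. f A = 0)}"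
    using assms(1) unfolding zariski_closed_def by blast
  then show ?thesis
    using assms(2,3) invertible_map by (auto simp: subset_iff poly_fun_equivariant)
qed

text \<open>The same inverse as in \<open>weyl_galois_act\<close>, so that the two match after
  unfolding.\<close>

definition "s_inv = inv_into Qbar s"

lemma s_inv_s: "x \<in> Qbar \<Longrightarrow> s_inv (s x) = x"
  using bij by (simp add: s_inv_def bij_betw_def)

lemma s_s_inv: "x \<in> Qbar \<Longrightarrow> s (s_inv x) = x"
  using bij by (simp add: s_inv_def bij_betw_def f_inv_into_f)

lemma s_inv_closed: "x \<in> Qbar \<Longrightarrow> s_inv x \<in> Qbar"
  using bij by (metis s_inv_def bij_betw_def inv_into_into)

lemma galois_s_inv: "galois s_inv"
proof
  have b: "bij_betw s_inv Qbar Qbar"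
    unfolding s_inv_def by (rule bij_betw_inv_into[OF bij])
  have "s_inv (x + y) = s_inv x + s_inv y \<and> s_inv (x * y) = s_inv x * s_inv y"
    if "x \<in> Qbar" "y \<in> Qbar" for x y
  proof -
    have "x = s (s_inv x)" "y = s (s_inv y)"
      using that by (simp_all add: s_s_inv)
    then have "x + y = s (s_inv x + s_inv y)" "x * y = s (s_inv x * s_inv y)"
      using that by (simp_all add: add mult s_inv_closed)
    then show ?thesis
      using that by (simp add: s_inv_s s_inv_closed Qbar_closed)
  qed
  moreover have "s_inv q = q" if "q \<in> \<rat>" for q
    using that s_inv_s[of q] subfield_C_rat[OF subfield_C_Qbar] by (simp add: rat)
  ultimately show "s_inv \<in> Gal_Qbar"
    using b by (auto simp: Gal_Qbar_def)
qed

end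


section \<open>Laurent polynomials\<close>

text \<open>The regular functions on the multiplicative group. The value at 0 is left free, as it is
  for cocharacters.\<close>

definition laurent :: "complex set \<Rightarrow> (complex \<Rightarrow> complex) \<Rightarrow> bool" where
  "laurent K f \<longleftrightarrow> (\<exists>q k. (\<forall>i. coeff q i \<in> K) \<and> (\<forall>z. z \<noteq> 0 \<longrightarrow> f z = poly q z / z ^ k))"

lemma laurentI:
  assumes "\<And>i. coeff q i \<in> K" "\<And>z. z \<noteq> 0 \<Longrightarrow> f z = poly q z / z ^ k"
  shows "laurent K f"
  using assms unfolding laurent_def by blast

lemma laurent_cong: "(\<And>z. z \<noteq> 0 \<Longrightarrow> f z = g z) \<Longrightarrow> laurent K f \<longleftrightarrow> laurent K g"
  by (simp add: laurent_def)

context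
  fixes K :: "complex set"
  assumes K: "subfield_C K"
begin

lemma laurent_const: "c \<in> K \<Longrightarrow> laurent K (\<lambda>z. c)"
  by (rule laurentI[of "[:c:]" _ _ 0]) (auto simp: coeff_pCons subfield_C_0[OF K] split: nat.split)

lemma laurent_id: "laurent K (\<lambda>z. z)"
  by (rule laurentI[of "[:0, 1:]" _ _ 0])
    (auto simp: coeff_pCons subfield_C_0[OF K] subfield_C_1[OF K] split: nat.split)

lemma laurent_reciprocal: "laurent K (\<lambda>z. 1 / z)"
  by (rule laurentI[of "[:1:]" _ _ 1])
    (auto simp: coeff_pCons subfield_C_0[OF K] subfield_C_1[OF K] split: nat.split)

lemma coeff_mult_in: "(\<And>i. coeff p i \<in> K) \<Longrightarrow> (\<And>i. coeff q i \<in> K) \<Longrightarrow> coeff (p * q) i \<in> K"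
  unfolding coeff_mult by (intro subfield_C_sum[OF K] subfield_C_mult[OF K])

lemma laurent_mult:
  assumes "laurent K f" "laurent K g"
  shows "laurent K (\<lambda>z. f z * g z)"
proof -
  obtain q k where q: "\<And>i. coeff q i \<in> K" "\<And>z. z \<noteq> 0 \<Longrightarrow> f z = poly q z / z ^ k"
    using assms(1) unfolding laurent_def by blast
  obtain r l where r: "\<And>i. coeff r i \<in> K" "\<And>z. z \<noteq> 0 \<Longrightarrow> g z = poly r z / z ^ l"
    using assms(2) unfolding laurent_def by blast
  show ?thesis
    by (rule laurentI[of "q * r" _ _ "k + l"])
      (auto simp: q(2) r(2) power_add intro: coeff_mult_in q(1) r(1))
qed

lemma laurent_add:
  assumes "laurent K f" "laurent K g"
  shows "laurent K (\<lambda>z. f z + g z)"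
proof -
  obtain q k where q: "\<And>i. coeff q i \<in> K" "\<And>z. z \<noteq> 0 \<Longrightarrow> f z = poly q z / z ^ k"
    using assms(1) unfolding laurent_def by blast
  obtain r l where r: "\<And>i. coeff r i \<in> K" "\<And>z. z \<noteq> 0 \<Longrightarrow> g z = poly r z / z ^ l"
    using assms(2) unfolding laurent_def by blast
  have m: "coeff (monom 1 n) i \<in> K" for n i
    using subfield_C_0[OF K] subfield_C_1[OF K] by simp
  show ?thesis
  proof (rule laurentI[of "q * monom 1 l + r * monom 1 k" _ _ "k + l"])
    show "coeff (q * monom 1 l + r * monom 1 k) i \<in> K" for i
      unfolding coeff_add by (intro subfield_C_add[OF K] coeff_mult_in q(1) r(1) m)
  qed (simp add: q(2) r(2) power_add poly_monom field_simps)
qed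

lemma laurent_sum: "(\<And>i. i \<in> I \<Longrightarrow> laurent K (f i)) \<Longrightarrow> laurent K (\<lambda>z. \<Sum>i\<in>I. f i z)"
  by (induction I rule: infinite_finite_induct)
    (auto intro: laurent_const laurent_add subfield_C_0[OF K])

lemma laurent_power: "laurent K f \<Longrightarrow> laurent K (\<lambda>z. f z ^ n)"
  by (induction n) (auto intro: laurent_const laurent_mult subfield_C_1[OF K])

lemma laurent_power_int: "laurent K (\<lambda>z. z powi m)"
proof (cases "m \<ge> 0")
  case True
  then show ?thesis
    using laurent_power[OF laurent_id, of "nat m"] by (simp add: power_int_def)
next
  case False
  then show ?thesis
    using laurent_power[OF laurent_reciprocal, of "nat (- m)"]
    by (simp add: power_int_def inverse_eq_divide)
qed

end

definition laurent_mat :: "complex set \<Rightarrow> (complex \<Rightarrow> 'n::finite cmat) \<Rightarrow> bool" where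
  "laurent_mat K l \<longleftrightarrow> (\<forall>i j. laurent K (\<lambda>z. l z $ i $ j))"

lemma laurent_matD: "laurent_mat K l \<Longrightarrow> laurent K (\<lambda>z. l z $ i $ j)"
  by (simp add: laurent_mat_def)

context
  fixes K :: "complex set"
  assumes K: "subfield_C K"
begin

lemma laurent_poly_fun:
  assumes "laurent_mat K l" "p \<in> poly_fun K"
  shows "laurent K (\<lambda>z. p (l z))"
  using assms(2)
  by induction (auto intro: laurent_const[OF K] laurent_matD[OF assms(1)] laurent_add[OF K] laurent_mult[OF K])

lemma laurent_det: "laurent_mat K l \<Longrightarrow> laurent K (\<lambda>z. det (l z))"
  by (rule laurent_poly_fun[OF _ poly_fun_det[OF K]])

lemma laurent_mat_const: "entries_in K A \<Longrightarrow> laurent_mat K (\<lambda>z. A)"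
  by (auto simp: laurent_mat_def entries_in_def intro: laurent_const[OF K])

lemma laurent_mat_mult: "laurent_mat K l \<Longrightarrow> laurent_mat K l' \<Longrightarrow> laurent_mat K (\<lambda>z. l z ** l' z)"
  unfolding laurent_mat_def matrix_mult_entry
  by (intro allI laurent_sum[OF K] laurent_mult[OF K]) auto

lemma laurent_mat_add: "laurent_mat K l \<Longrightarrow> laurent_mat K l' \<Longrightarrow> laurent_mat K (\<lambda>z. l z + l' z)"
  unfolding laurent_mat_def by (auto intro: laurent_add[OF K])

lemma laurent_mat_scalar: "laurent_mat K (\<lambda>z. mat z :: 'n::finite cmat)"
  unfolding laurent_mat_def
proof (intro allI)
  fix i j :: 'n
  show "laurent K (\<lambda>z. mat z $ i $ j)"
    by (cases "i = j") (auto simp: mat_def intro: laurent_const[OF K] subfield_C_0[OF K] laurent_id[OF K])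
qed

end

text \<open>Clearing denominators gives a polynomial that vanishes at infinitely many algebraic
  numbers. The coefficient fields may differ, so one side can involve transcendental
  constants.\<close>

lemma laurent_eq:
  assumes "laurent K f" "laurent L g"
    and eq: "\<And>z. z \<in> Qbar \<Longrightarrow> z \<noteq> 0 \<Longrightarrow> f z = g z"
    and "z \<noteq> 0"
  shows "f z = g z"
proof -
  obtain q k where q: "\<And>z. z \<noteq> 0 \<Longrightarrow> f z = poly q z / z ^ k"
    using assms(1) unfolding laurent_def by blast
  obtain r l where r: "\<And>z. z \<noteq> 0 \<Longrightarrow> g z = poly r z / z ^ l"
    using assms(2) unfolding laurent_def by blast
  let ?p = "q * monom 1 l - r * monom 1 k"
  have "Qbar - {0} \<subseteq> {z. poly ?p z = 0}"
    using eq by (auto simp: q r poly_monom field_simps)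
  then have "infinite {z. poly ?p z = 0}"
    using Qbar_infinite finite_subset by blast
  then have "?p = 0"
    using poly_roots_finite by blast
  then have "poly ?p z = 0"
    by simp
  then show ?thesis
    using \<open>z \<noteq> 0\<close> by (simp add: q r poly_monom field_simps)
qed

lemma laurent_mat_eq:
  assumes "laurent_mat K l" "laurent_mat L l'"
    and "\<And>z. z \<in> Qbar \<Longrightarrow> z \<noteq> 0 \<Longrightarrow> l z = l' z" and "z \<noteq> 0"
  shows "l z = l' z"
  unfolding vec_eq_iff
  by (intro allI laurent_eq[OF laurent_matD[OF assms(1)] laurent_matD[OF assms(2)] _ assms(4)])
    (simp add: assms(3))

text \<open>For fixed algebraic \<open>w\<close> the powers of z cancel and q(w z) = q(w) q(z)
  becomes an identity of polynomials in z. Comparing one nonzero coefficient, of degree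
  \<open>i\<close>, gives q(w) = w^i, so \<open>f\<close> is a single power.\<close>

lemma laurent_hom:
  assumes "laurent K f" and one: "f 1 = 1"
    and mult: "\<And>z w. z \<in> Qbar \<Longrightarrow> w \<in> Qbar \<Longrightarrow> z \<noteq> 0 \<Longrightarrow> w \<noteq> 0 \<Longrightarrow> f (z * w) = f z * f w"
  obtains m :: int where "\<And>z. z \<noteq> 0 \<Longrightarrow> f z = z powi m"
proof -
  obtain q k where q: "\<And>z. z \<noteq> 0 \<Longrightarrow> f z = poly q z / z ^ k"
    using assms(1) unfolding laurent_def by blast
  have "q \<noteq> 0"
    using one q[of 1] by auto
  then obtain i where i: "coeff q i \<noteq> 0"
    using leading_coeff_0_iff by blast
  have "f w = w powi (int i - int k)" if w: "w \<in> Qbar" "w \<noteq> 0" for w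
  proof -
    let ?p = "pcompose q [:0, w:] - smult (poly q w) q"
    have "poly ?p z = 0" if "z \<in> Qbar" "z \<noteq> 0" for z
    proof -
      have "poly q (w * z) / (w * z) ^ k = (poly q w / w ^ k) * (poly q z / z ^ k)"
        using mult[of w z] q w that by simp
      then show ?thesis
        using w that by (simp add: poly_pcompose field_simps power_mult_distrib)
    qed
    then have "Qbar - {0} \<subseteq> {z. poly ?p z = 0}"
      by blast
    then have "infinite {z. poly ?p z = 0}"
      using Qbar_infinite finite_subset by blast
    then have "?p = 0"
      using poly_roots_finite by blast
    then have "coeff (pcompose q [:0, w:]) i = poly q w * coeff q i"
      by (simp add: poly_eq_iff)
    then have "poly q w = w ^ i"
      using i by (simp add: coeff_pcompose_linear)
    then show ?thesis
      using w q by (simp add: power_int_diff)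
  qed
  then show ?thesis
    using laurent_eq[OF assms(1) laurent_power_int[OF subfield_C_Qbar]] that by blast
qed

lemma laurent_differentiable:
  assumes "laurent K f"
  obtains d where "(f has_field_derivative d) (at 1)"
proof -
  obtain q k where q: "\<And>z. z \<noteq> 0 \<Longrightarrow> f z = poly q z / z ^ k"
    using assms unfolding laurent_def by blast
  have "((\<lambda>z. poly q z / z ^ k) has_field_derivative
      (poly (pderiv q) 1 * 1 ^ k - poly q 1 * (of_nat k * 1 ^ (k - 1))) / (1 ^ k * 1 ^ k)) (at 1)"
    by (auto intro!: derivative_eq_intros)
  then have "(f has_field_derivative
      (poly (pderiv q) 1 * 1 ^ k - poly q 1 * (of_nat k * 1 ^ (k - 1))) / (1 ^ k * 1 ^ k)) (at 1)"
    by (rule has_field_derivative_transform_within_open[of _ _ _ "- {0}"]) (auto simp: q)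
  then show ?thesis
    by (rule that)
qed

text \<open>Composing with \<open>s\<close> leaves the Laurent polynomials; applying
  \<open>s\<close> to the coefficients instead gives the conjugate of \<open>f\<close> by
  \<open>s\<close> on algebraic points.\<close>

lemma (in galois) laurent_twist:
  assumes "laurent Qbar f"
  obtains g where "laurent Qbar g" "\<And>z. z \<in> Qbar \<Longrightarrow> z \<noteq> 0 \<Longrightarrow> g (s z) = s (f z)"
proof -
  obtain q k where q: "\<And>i. coeff q i \<in> Qbar" "\<And>z. z \<noteq> 0 \<Longrightarrow> f z = poly q z / z ^ k"
    using assms unfolding laurent_def by blast
  show ?thesis
  proof
    show "laurent Qbar (\<lambda>z. poly (map_poly s q) z / z ^ k)"
      using q(1) by (intro laurentI[OF _ refl]) (simp add: coeff_map_poly closed)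
    show "poly (map_poly s q) (s z) / s z ^ k = s (f z)" if "z \<in> Qbar" "z \<noteq> 0" for z
      using that q subfield_C_poly[OF subfield_C_Qbar, of q z]
      by (simp add: divide power Qbar_closed poly)
  qed
qed

lemma (in galois) laurent_mat_twist:
  assumes "laurent_mat Qbar l"
  obtains l' where "laurent_mat Qbar l'"
    "\<And>z. z \<in> Qbar \<Longrightarrow> z \<noteq> 0 \<Longrightarrow> l' (s z) = map_matrix s (l z)"
proof -
  have "\<forall>i j. \<exists>g. laurent Qbar g \<and> (\<forall>z\<in>Qbar. z \<noteq> 0 \<longrightarrow> g (s z) = s (l z $ i $ j))"
    using laurent_twist[OF laurent_matD[OF assms]] by metis
  then obtain g where g: "\<And>i j. laurent Qbar (g i j)"
    "\<And>i j z. z \<in> Qbar \<Longrightarrow> z \<noteq> 0 \<Longrightarrow> g i j (s z) = s (l z $ i $ j)"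
    by metis
  show ?thesis
    by (rule that[of "\<lambda>z. \<chi> i j. g i j z"]) (auto simp: laurent_mat_def vec_eq_iff g)
qed

lemma mat_1_in_Gm: "z \<noteq> 0 \<Longrightarrow> (mat z :: 1 cmat) \<in> Gm"
  by (simp add: Gm_def invertible_det_nz det_def mat_def)

lemma det_1: "det (A :: 1 cmat) = A $ 1 $ 1"
  by (simp add: det_def)

lemma Gm_iff: "A \<in> Gm \<longleftrightarrow> A $ 1 $ 1 \<noteq> 0"
  by (simp add: Gm_def invertible_det_nz det_1)

lemma mat_1_entry: "(mat z :: 1 cmat) $ 1 $ 1 = z"
  by (simp add: mat_def)

text \<open>On \<open>GL_1\<close> the determinant is the coordinate itself, so the denominators in
  \<open>regular_on\<close> are powers of z.\<close>

lemma regular_on_Gm_iff: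
  assumes K: "subfield_C K"
  shows "regular_on K Gm (\<lambda>A. f (A $ 1 $ 1)) \<longleftrightarrow> laurent K f"
proof
  assume "regular_on K Gm (\<lambda>A. f (A $ 1 $ 1))"
  then obtain p k where p: "p \<in> poly_fun K" "\<forall>A\<in>Gm. f (A $ 1 $ 1) = p A / det A ^ k"
    unfolding regular_on_def by blast
  have "f z = p (mat z) * (1 / z) ^ k" if "z \<noteq> 0" for z
    using p(2) mat_1_in_Gm[OF that] by (metis det_1 mat_1_entry power_one_over times_divide_eq_right mult.right_neutral)
  moreover have "laurent K (\<lambda>z. p (mat z) * (1 / z) ^ k)"
    by (intro laurent_mult[OF K] laurent_power[OF K] laurent_reciprocal[OF K]
        laurent_poly_fun[OF K laurent_mat_scalar[OF K] p(1)])
  ultimately show "laurent K f"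
    using laurent_cong[of f "\<lambda>z. p (mat z) * (1 / z) ^ k"] by blast
next
  assume "laurent K f"
  then obtain q k where q: "\<And>i. coeff q i \<in> K" "\<And>z. z \<noteq> 0 \<Longrightarrow> f z = poly q z / z ^ k"
    unfolding laurent_def by blast
  have "(\<lambda>A :: 1 cmat. poly q (A $ 1 $ 1)) \<in> poly_fun K"
    unfolding poly_altdef
    by (intro poly_fun_sum[OF K] poly_fun.mult poly_fun.const q(1) poly_fun_power[OF K] poly_fun.coord)
  then show "regular_on K Gm (\<lambda>A. f (A $ 1 $ 1))"
    unfolding regular_on_def
    by (rule bexI[rotated]) (auto intro!: exI[of _ k] simp: q(2) Gm_iff det_1)
qed


section \<open>Derivatives at the identity\<close>

text \<open>For a cocharacter composed with \<psi> this is its image in the Lie algebra, obtained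
  without diagonalising.\<close>

definition mat_deriv :: "(complex \<Rightarrow> 'n::finite cmat) \<Rightarrow> 'n cmat \<Rightarrow> bool" where
  "mat_deriv R N \<longleftrightarrow> (\<forall>i j. ((\<lambda>z. R z $ i $ j) has_field_derivative N $ i $ j) (at 1))"

lemma laurent_mat_deriv:
  assumes "laurent_mat K R"
  obtains N where "mat_deriv R N"
proof -
  have "\<forall>i j. \<exists>d. ((\<lambda>z. R z $ i $ j) has_field_derivative d) (at 1)"
    using laurent_differentiable[OF laurent_matD[OF assms]] by metis
  then obtain d where "\<forall>i j. ((\<lambda>z. R z $ i $ j) has_field_derivative d i j) (at 1)"
    by metis
  then show ?thesis
    by (intro that[of "\<chi> i j. d i j"]) (simp add: mat_deriv_def)
qed

lemma mat_deriv_cong: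
  assumes "mat_deriv R N" "\<And>z. z \<noteq> 0 \<Longrightarrow> R z = R' z"
  shows "mat_deriv R' N"
  unfolding mat_deriv_def
proof (intro allI)
  fix i j
  from assms(1) have "((\<lambda>z. R z $ i $ j) has_field_derivative N $ i $ j) (at 1)"
    by (simp add: mat_deriv_def)
  then show "((\<lambda>z. R' z $ i $ j) has_field_derivative N $ i $ j) (at 1)"
    by (rule has_field_derivative_transform_within_open[of _ _ _ "- {0}"]) (auto simp: assms(2))
qed

lemma mat_deriv_unique: "mat_deriv R N \<Longrightarrow> mat_deriv R N' \<Longrightarrow> N = N'"
  unfolding mat_deriv_def vec_eq_iff using DERIV_unique by blast

lemma mat_deriv_const: "mat_deriv (\<lambda>z. A) 0"
  by (simp add: mat_deriv_def)

lemma mat_deriv_add: "mat_deriv R N \<Longrightarrow> mat_deriv S M \<Longrightarrow> mat_deriv (\<lambda>z. R z + S z) (N + M)"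
  unfolding mat_deriv_def by (auto intro!: derivative_eq_intros)

lemma mat_deriv_mult:
  assumes "mat_deriv R N" "mat_deriv S M"
  shows "mat_deriv (\<lambda>z. R z ** S z) (N ** S 1 + R 1 ** M)"
  unfolding mat_deriv_def matrix_mult_entry
proof (intro allI)
  fix i j
  have "((\<lambda>z. \<Sum>k\<in>UNIV. R z $ i $ k * S z $ k $ j) has_field_derivative
      (\<Sum>k\<in>UNIV. N $ i $ k * S 1 $ k $ j + M $ k $ j * R 1 $ i $ k)) (at 1)"
    using assms unfolding mat_deriv_def by (intro DERIV_sum DERIV_mult) auto
  then show "((\<lambda>z. \<Sum>k\<in>UNIV. R z $ i $ k * S z $ k $ j) has_field_derivative
      (N ** S 1 + R 1 ** M) $ i $ j) (at 1)"
    by (simp add: matrix_mult_entry sum.distrib mult.commute)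
qed

lemma mat_deriv_scalar: "mat_deriv (\<lambda>z. mat z) (mat 1)"
  by (auto simp: mat_deriv_def mat_def intro!: derivative_eq_intros)

lemma mat_mult_entry: "((mat c :: 'n::finite cmat) ** A) $ i $ j = c * A $ i $ j"
  by (simp add: matrix_mult_entry mat_def if_distrib[of "\<lambda>x. x * _"] cong: if_cong)

lemma mat_deriv_power_int:
  assumes "mat_deriv R N"
  shows "mat_deriv (\<lambda>z. R (z powi k)) (mat (of_int k) ** N)"
  unfolding mat_deriv_def
proof (intro allI)
  fix i j
  have "((\<lambda>z. z powi k) has_field_derivative of_int k) (at (1::complex))"
    by (auto intro!: derivative_eq_intros)
  moreover have "((\<lambda>z. R z $ i $ j) has_field_derivative N $ i $ j) (at ((1::complex) powi k))"
    using assms by (simp add: mat_deriv_def)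
  ultimately have "((\<lambda>z. R (z powi k) $ i $ j) has_field_derivative N $ i $ j * of_int k) (at 1)"
    by (rule DERIV_chain2[rotated])
  then show "((\<lambda>z. R (z powi k) $ i $ j) has_field_derivative (mat (of_int k) ** N) $ i $ j) (at 1)"
    by (simp add: mat_mult_entry mult.commute)
qed

text \<open>A permutation other than the identity moves at least two points, so after one factor is
  differentiated an off-diagonal entry of the identity matrix still remains in the product.\<close>

lemma det_deriv:
  fixes R :: "complex \<Rightarrow> 'n::finite cmat"
  assumes "mat_deriv R N" and R1: "R 1 = mat 1"
  shows "((\<lambda>z. det (R z)) has_field_derivative trace N) (at 1)"
proof -
  let ?P = "{p. p permutes (UNIV :: 'n set)}"
  let ?d = "\<lambda>p. of_int (sign p) * (\<Sum>i\<in>UNIV. N $ i $ p i * (\<Prod>j\<in>UNIV - {i}. R 1 $ j $ p j))"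
  have "((\<lambda>z. det (R z)) has_field_derivative (\<Sum>p\<in>?P. ?d p)) (at 1)"
    unfolding det_def using assms(1) unfolding mat_deriv_def
    by (intro DERIV_sum DERIV_cmult has_field_derivative_prod) auto
  moreover have "(\<Sum>p\<in>?P. ?d p) = (\<Sum>p\<in>{id}. ?d p)"
  proof (rule sum.mono_neutral_right)
    show "\<forall>p \<in> ?P - {id}. ?d p = 0"
    proof
      fix p assume p: "p \<in> ?P - {id}"
      have "(\<Prod>j\<in>UNIV - {i}. R 1 $ j $ p j) = 0" for i
      proof -
        have "\<exists>j. j \<noteq> i \<and> p j \<noteq> j"
        proof (rule ccontr)
          assume "\<not> ?thesis"
          then have fix_p: "\<And>j. j \<noteq> i \<Longrightarrow> p j = j"
            by auto
          have "inj p"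
            using p permutes_inj by blast
          then have "p i = i"
            using fix_p[of "p i"] by (metis injD)
          then have "p = id"
            using fix_p by (metis eq_id_iff)
          then show False
            using p by simp
        qed
        then obtain j where "j \<noteq> i" "R 1 $ j $ p j = 0"
          by (auto simp: R1 mat_def)
        then show ?thesis
          by (intro prod_zero) auto
      qed
      then show "?d p = 0"
        by (simp del: prod_zero_iff)
    qed
  qed (auto simp: permutes_id)
  moreover have "(\<Sum>p\<in>{id}. ?d p) = trace N"
    by (simp add: R1 mat_def trace_def)
  ultimately show ?thesis
    by simp
qed

text \<open>The determinant is a character of the multiplicative group, hence a power of z, and
  differentiating at 1 turns its exponent into a trace. This is the bridge from pairings to the
  trace form.\<close>

lemma det_hom_eq_power:
  fixes R :: "complex \<Rightarrow> 'n::finite cmat"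
  assumes "laurent_mat K R" "subfield_C K" "mat_deriv R N" "R 1 = mat 1"
    and "\<And>z w. z \<noteq> 0 \<Longrightarrow> w \<noteq> 0 \<Longrightarrow> R (z * w) = R z ** R w"
  obtains m :: int where "trace N = of_int m" "\<And>z. z \<noteq> 0 \<Longrightarrow> det (R z) = z powi m"
proof -
  obtain m where m: "\<And>z. z \<noteq> 0 \<Longrightarrow> det (R z) = z powi m"
    using laurent_hom[OF laurent_det[OF assms(2,1)]] assms(4,5) by (auto simp: det_mul)
  have "((\<lambda>z. z powi m) has_field_derivative of_int m) (at (1::complex))"
    by (auto intro!: derivative_eq_intros)
  then have "((\<lambda>z. det (R z)) has_field_derivative of_int m) (at 1)"
    by (rule has_field_derivative_transform_within_open[of _ _ _ "- {0}"]) (auto simp: m)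
  then have "trace N = of_int m"
    using det_deriv[OF assms(3,4)] DERIV_unique by blast
  then show ?thesis
    using m that by blast
qed


section \<open>Determinants on subspaces\<close>

text \<open>A permutation moving some \<open>k\<close> outside \<open>I\<close> sends another index
  to \<open>k\<close>, and so picks a zero of the \<open>k\<close>-th column.\<close>

lemma det_identity_columns:
  fixes N :: "'n::finite cmat"
  assumes col: "\<And>i j. j \<notin> I \<Longrightarrow> N $ i $ j = (if i = j then 1 else 0)"
  shows "det N = (\<Sum>p | p permutes I. of_int (sign p) * (\<Prod>i\<in>I. N $ i $ p i))"
proof -
  have "det N = (\<Sum>p | p permutes I. of_int (sign p) * (\<Prod>i\<in>UNIV. N $ i $ p i))"
    unfolding det_def
  proof (rule sum.mono_neutral_right)
    show "{p. p permutes I} \<subseteq> {p. p permutes UNIV}"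
      using permutes_subset by blast
    show "\<forall>p \<in> {p. p permutes UNIV} - {p. p permutes I}. of_int (sign p) * (\<Prod>i\<in>UNIV. N $ i $ p i) = 0"
    proof
      fix p assume "p \<in> {p. p permutes UNIV} - {p. p permutes I}"
      then have p: "p permutes UNIV" "\<not> p permutes I"
        by auto
      then obtain k where k: "k \<notin> I" "p k \<noteq> k"
        by (metis permutes_superset Diff_iff UNIV_I)
      moreover obtain i where "p i = k"
        using permutes_surj[OF p(1)] by (metis surjD)
      ultimately have "N $ i $ p i = 0"
        using col[of k i] by auto
      then have "(\<Prod>i\<in>UNIV. N $ i $ p i) = 0"
        by (intro prod_zero) auto
      then show "of_int (sign p) * (\<Prod>i\<in>UNIV. N $ i $ p i) = 0"
        by simp
    qed
  qed auto
  also have "\<dots> = (\<Sum>p | p permutes I. of_int (sign p) * (\<Prod>i\<in>I. N $ i $ p i))"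
  proof (rule sum.cong[OF refl])
    fix p assume "p \<in> {p. p permutes I}"
    then have "(\<Prod>i\<in>UNIV. N $ i $ p i) = (\<Prod>i\<in>I. N $ i $ p i)"
      by (intro prod.mono_neutral_right) (auto simp: permutes_not_in col)
    then show "of_int (sign p) * (\<Prod>i\<in>UNIV. N $ i $ p i) = of_int (sign p) * (\<Prod>i\<in>I. N $ i $ p i)"
      by simp
  qed
  finally show ?thesis .
qed

text \<open>The Leibniz sum in \<open>det_on\<close> runs over permutations of basis vectors, that
  of \<open>det\<close> over permutations of indices; conjugating permutations by \<open>e\<close>
  matches the two, signs included.\<close>

lemma sum_permutes_transfer:
  fixes e :: "'a \<Rightarrow> 'b" and f :: "'b \<Rightarrow> 'b \<Rightarrow> complex"
  assumes e: "bij_betw e I B" and fin: "finite I"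
  shows "(\<Sum>p | p permutes B. of_int (sign p) * (\<Prod>b\<in>B. f b (p b))) =
    (\<Sum>p | p permutes I. of_int (sign p) * (\<Prod>i\<in>I. f (e i) (e (p i))))"
proof -
  have inj: "inj_on e I" and im: "e ` I = B"
    using e by (auto simp: bij_betw_def)
  define e' where "e' = inv_into I e"
  have e': "bij_betw e' B I" "\<And>i. i \<in> I \<Longrightarrow> e' (e i) = i" "\<And>b. b \<in> B \<Longrightarrow> e (e' b) = b"
    using e inj im by (auto simp: e'_def bij_betw_inv_into f_inv_into_f)
  show ?thesis
  proof (rule sum.reindex_bij_witness[of _ "map_permutation I e" "map_permutation B e'"], goal_cases)
    case (1 p)
    then show ?case
      using e'(1,3) map_permutation_compose_inv by blast
  next
    case (2 p)
    then show ?case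
      using e'(1) map_permutation_permutes by blast
  next
    case (3 p)
    then show ?case
      using e e'(2) map_permutation_compose_inv by blast
  next
    case (4 p)
    then show ?case
      using e map_permutation_permutes by blast
  next
    case (5 p)
    then have p: "p permutes B"
      by simp
    have finB: "finite B" and inj': "inj_on e' B"
      using fin im e'(1) by (auto simp: bij_betw_def)
    have "(\<Prod>i\<in>I. f (e i) (e (map_permutation B e' p i))) = (\<Prod>b\<in>B. f b (p b))"
    proof (rule prod.reindex_bij_witness[of _ e' e], goal_cases)
      case (5 i)
      then have ei: "e i \<in> B"
        using im by blast
      have "map_permutation B e' p (e' (e i)) = e' (p (e i))"
        by (rule map_permutation_apply[OF inj' ei])
      then have "e (map_permutation B e' p i) = p (e i)"
        using 5 e'(2,3) ei permutes_in_image[OF p] by simp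
      then show ?case
        by simp
    qed (use e'(1-3) im in \<open>auto simp: bij_betw_def\<close>)
    then show ?case
      using sign_map_permutation[OF inj' p finB] by simp
  qed
qed

text \<open>Extend a basis of \<open>U\<close> to the whole space: outside \<open>U\<close>, the matrix \<open>A ** P + (mat 1 - P)\<close> acts
  as the identity modulo \<open>U\<close>.\<close>

lemma det_on_eq_det:
  fixes A P :: "'n::finite cmat"
  assumes P: "P ** P = P" and comm: "A ** P = P ** A" and U: "U = {v. P *v v = v}"
  shows "det_on U A = det (A ** P + (mat 1 - P))"
proof -
  have PU: "P *v v \<in> U" for v
    using P by (simp add: U matrix_vector_mul_assoc)
  have AU: "A *v v \<in> U" if "v \<in> U" for v
    using that comm by (metis (mono_tags, lifting) U matrix_vector_mul_assoc mem_Collect_eq)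
  have subU: "vec.subspace U"
    unfolding U by (rule vec.subspaceI) (auto simp: vec.add vec.scale)
  \<comment> \<open>The very basis chosen inside \<open>det_on\<close>, since the two
    \<open>SOME\<close> terms coincide.\<close>
  define B where "B = (SOME B. vec.independent B \<and> vec.span B = U)"
  have "\<exists>B. vec.independent B \<and> vec.span B = U"
    using vec.maximal_independent_subset[of U] subU vec.span_minimal by (metis subset_antisym)
  then have B: "vec.independent B" "vec.span B = U"
    unfolding B_def by (metis (mono_tags, lifting) someI_ex)+
  define C where "C = vec.extend_basis B"
  have C: "B \<subseteq> C" "vec.independent C" "vec.span C = UNIV"
    unfolding C_def using B(1)
    by (simp_all add: vec.extend_basis_superset vec.independent_extend_basis)
  have finC: "finite C"
    using C(2) by (rule vec.finiteI_independent)
  have "card C = CARD('n)"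
    using C vec.basis_card_eq_dim[of C UNIV] vec_dim_card by auto
  then obtain e :: "'n \<Rightarrow> complex ^ 'n" where e: "bij_betw e UNIV C"
    using finC by (metis finite_same_card_bij finite)
  have inj: "inj e" and im: "range e = C"
    using e by (auto simp: bij_betw_def)
  define I where "I = e -` B"
  have eI: "bij_betw e I B"
    using inj im C(1) by (auto simp: I_def bij_betw_def inj_on_def)
  let ?X = "A ** P + (mat 1 - P)"
  let ?rep = "vec.representation C"
  have sum_rep: "(\<Sum>i\<in>UNIV. ?rep v (e i) *s e i) = v" for v
  proof -
    have "(\<Sum>i\<in>UNIV. ?rep v (e i) *s e i) = (\<Sum>c\<in>C. ?rep v c *s c)"
      by (rule sum.reindex_bij_betw[OF e])
    also have "\<dots> = v"
      using C finC by (intro vec.sum_representation_eq) auto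
    finally show ?thesis .
  qed
  define S :: "'n cmat" where "S = (\<chi> a j. e j $ a)"
  \<comment> \<open>The matrix of \<open>?X\<close> in the extended basis; \<open>S\<close> is the
    change of basis.\<close>
  define M :: "'n cmat" where "M = (\<chi> i j. ?rep (?X *v e j) (e i))"
  have colS: "column j S = e j" for j
    by (simp add: column_def S_def vec_eq_iff)
  have "columns S = C"
    using im by (auto simp: columns_def colS)
  then have "\<exists>S'. S ** S' = mat 1"
    using matrix_right_invertible_span_columns[of S] C(3) by simp
  then have detS: "det S \<noteq> 0"
    using invertible_right_inverse invertible_det_nz by blast
  have "S ** M = ?X ** S"
    unfolding vec_eq_iff
  proof (intro allI)
    fix a j
    have "(S ** M) $ a $ j = (\<Sum>i\<in>UNIV. ?rep (?X *v e j) (e i) *s e i) $ a"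
      by (simp add: matrix_mult_entry S_def M_def mult.commute)
    also have "\<dots> = (?X *v e j) $ a"
      by (simp add: sum_rep)
    also have "\<dots> = (?X ** S) $ a $ j"
      by (simp add: matrix_mult_entry matrix_vector_mult_def S_def)
    finally show "(S ** M) $ a $ j = (?X ** S) $ a $ j" .
  qed
  then have "det S * det M = det ?X * det S"
    by (metis det_mul)
  then have detM: "det M = det ?X"
    using detS by simp
  have repU: "?rep v = vec.representation B v" if "v \<in> U" for v
    using vec.representation_extend[OF C(2) _ C(1)] B(2) that by simp
  have XU: "?X *v v = A *v v" if "v \<in> U" for v
    using that by (simp add: U matrix_vector_mult_add_rdistrib matrix_vector_mult_diff_rdistrib
        matrix_vector_mul_assoc[symmetric])
  \<comment> \<open>In \<open>det_on\<close> the factor for a basis vector is the coefficient of its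
    image at the permuted vector. Source vectors must therefore index rows, whence the
    transpose.\<close>
  have col: "transpose M $ i $ j = (if i = j then 1 else 0)" if "j \<notin> I" for i j
  proof (cases "e i \<in> B")
    case True
    then have "e i \<in> U"
      using B(2) vec.span_base by blast
    then have "?rep (?X *v e i) = vec.representation B (A *v e i)"
      using XU AU repU by simp
    moreover have "e j \<notin> B"
      using that by (simp add: I_def)
    ultimately have "?rep (?X *v e i) (e j) = 0"
      using vec.representation_ne_zero by metis
    moreover have "i \<noteq> j"
      using True that by (auto simp: I_def)
    ultimately show ?thesis
      by (simp add: transpose_def M_def)
  next
    case False
    define u where "u = A *v (P *v e i) - P *v e i"
    have u: "u \<in> U"
      unfolding u_def by (intro vec.subspace_diff[OF subU] AU PU)
    have "?X *v e i = e i + u"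
      by (simp add: u_def matrix_vector_mult_add_rdistrib matrix_vector_mult_diff_rdistrib
          matrix_vector_mul_assoc[symmetric])
    then have "?rep (?X *v e i) (e j) = ?rep (e i) (e j) + ?rep u (e j)"
      using C by (simp add: vec.representation_add)
    also have "?rep u (e j) = 0"
      using repU[OF u] vec.representation_ne_zero that by (metis I_def vimageI)
    also have "?rep (e i) (e j) = (if i = j then 1 else 0)"
      using vec.representation_basis[OF C(2), of "e i"] im inj by (auto dest: injD)
    finally show ?thesis
      by (simp add: transpose_def M_def)
  qed
  have "det ?X = det (transpose M)"
    by (simp add: detM)
  also have "\<dots> = (\<Sum>p | p permutes I. of_int (sign p) * (\<Prod>i\<in>I. transpose M $ i $ p i))"
    by (rule det_identity_columns) (rule col)
  also have "\<dots> = (\<Sum>p | p permutes I. of_int (sign p) *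
      (\<Prod>i\<in>I. vec.representation B (A *v e i) (e (p i))))"
  proof (intro sum.cong refl arg_cong2[of _ _ _ _ "(*)"] prod.cong)
    fix p i assume "i \<in> I"
    then have "e i \<in> U"
      using B(2) vec.span_base by (auto simp: I_def)
    then show "transpose M $ i $ p i = vec.representation B (A *v e i) (e (p i))"
      using XU AU repU by (simp add: transpose_def M_def)
  qed
  also have "\<dots> = (\<Sum>p | p permutes B. of_int (sign p) *
      (\<Prod>b\<in>B. vec.representation B (A *v b) (p b)))"
    using sum_permutes_transfer[OF eI, of "\<lambda>b. vec.representation B (A *v b)"] by simp
  also have "\<dots> = det_on U A"
    by (simp add: det_on_def B_def Let_def)
  finally show ?thesis ..
qed


section \<open>Algebraic groups, tori and cocharacters\<close>

lemma m_inv_matrix: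
  assumes "g \<in> H" "matrix_inv g \<in> H" "invertible g"
  shows "inv\<^bsub>mgroup H\<^esub> g = matrix_inv g"
  unfolding m_inv_def
proof (rule the_equality)
  show "matrix_inv g \<in> carrier (mgroup H) \<and>
      g \<otimes>\<^bsub>mgroup H\<^esub> matrix_inv g = \<one>\<^bsub>mgroup H\<^esub> \<and> matrix_inv g \<otimes>\<^bsub>mgroup H\<^esub> g = \<one>\<^bsub>mgroup H\<^esub>"
    using assms by (simp add: mgroup_def GL_def matrix_inv_left matrix_inv_right)
qed (auto simp: mgroup_def GL_def dest: matrix_inv_unique)

lemma mgroup_invertibles: "mgroup {A. invertible A} = GL"
  by (simp add: mgroup_def GL_def)

lemma alg_groupD:
  assumes "alg_group K G"
  shows alg_group_invertible: "g \<in> G \<Longrightarrow> invertible g"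
    and alg_group_mult: "g \<in> G \<Longrightarrow> h \<in> G \<Longrightarrow> g ** h \<in> G"
    and alg_group_one: "mat 1 \<in> G"
    and alg_group_inv: "g \<in> G \<Longrightarrow> matrix_inv g \<in> G"
    and alg_group_zariski_closed: "zariski_closed K G"
proof -
  have sub: "subgroup G GL" and zc: "zariski_closed K G"
    using assms by (auto simp: alg_group_def)
  show "zariski_closed K G"
    by (rule zc)
  show inv: "invertible g" if "g \<in> G" for g
    using subgroup.subset[OF sub] that by (auto simp: GL_def)
  show "g ** h \<in> G" if "g \<in> G" "h \<in> G"
    using subgroup.m_closed[OF sub that] by (simp add: GL_def)
  show "mat 1 \<in> G"
    using subgroup.one_closed[OF sub] by (simp add: GL_def)
  show "matrix_inv g \<in> G" if "g \<in> G"
    using subgroup.m_inv_closed[OF sub that] m_inv_matrix[of g "{A. invertible A}"] inv[OF that]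
    by (simp add: mgroup_invertibles invertible_matrix_inv)
qed

lemma alg_homD:
  assumes "alg_hom K G H f"
  shows alg_hom_closed: "g \<in> G \<Longrightarrow> f g \<in> H"
    and alg_hom_mult: "g \<in> G \<Longrightarrow> h \<in> G \<Longrightarrow> f (g ** h) = f g ** f h"
    and alg_hom_regular: "regular_on K G (\<lambda>g. f g $ i $ j)"
  using assms by (auto simp: alg_hom_def hom_def mgroup_def GL_def)

lemma alg_homI:
  assumes "\<And>g. g \<in> G \<Longrightarrow> f g \<in> H" "\<And>g h. g \<in> G \<Longrightarrow> h \<in> G \<Longrightarrow> f (g ** h) = f g ** f h"
    and "\<And>i j. regular_on K G (\<lambda>g. f g $ i $ j)"
  shows "alg_hom K G H f"
  using assms by (auto simp: alg_hom_def hom_def mgroup_def GL_def)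

lemma mat_mult_mat: "(mat x :: 'n::finite cmat) ** mat y = mat (x * y)"
  by (simp add: vec_eq_iff mat_mult_entry) (simp add: mat_def)

text \<open>The normalizer is a stabilizer for conjugation of subsets. Equality of \<open>T\<close>
  with its conjugate, rather than an inclusion, gives closure in both directions.\<close>

lemma normalizerD:
  assumes G: "alg_group K G" and n: "n \<in> normalizer (mgroup G) T" and "T \<subseteq> G"
  shows normalizer_in_group: "n \<in> G"
    and normalizer_conj: "t \<in> T \<Longrightarrow> conj_by n t \<in> T"
    and normalizer_conj_inv: "t \<in> T \<Longrightarrow> matrix_inv n ** t ** n \<in> T"
proof -
  show nG: "n \<in> G"
    using n by (simp add: normalizer_def stabilizer_def mgroup_def)
  have inv: "inv\<^bsub>mgroup G\<^esub> n = matrix_inv n"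
    by (rule m_inv_matrix[OF nG alg_group_inv[OF G nG] alg_group_invertible[OF G nG]])
  have "n <#\<^bsub>mgroup G\<^esub> T #>\<^bsub>mgroup G\<^esub> inv\<^bsub>mgroup G\<^esub> n = T"
    using n \<open>T \<subseteq> G\<close> by (simp add: normalizer_def stabilizer_def mgroup_def)
  then have "(\<lambda>t. conj_by n t) ` T = T"
    unfolding inv by (auto simp: l_coset_def r_coset_def mgroup_def GL_def conj_by_def)
  then have T: "T = (\<lambda>t. conj_by n t) ` T" ..
  show "conj_by n t \<in> T" if "t \<in> T"
    using T that by blast
  show "matrix_inv n ** t ** n \<in> T" if t: "t \<in> T"
  proof -
    obtain t' where t': "t' \<in> T" "t = conj_by n t'"
      using T t by blast
    have "matrix_inv n ** t ** n = (matrix_inv n ** n) ** t' ** (matrix_inv n ** n)"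
      by (simp add: t'(2) conj_by_def matrix_mul_assoc)
    also have "\<dots> = t'"
      by (simp add: matrix_inv_left[OF alg_group_invertible[OF G nG]])
    finally show ?thesis
      using t'(1) by simp
  qed
qed

text \<open>Diagonal matrices commute, and the isomorphism with a group of diagonal matrices carries
  this back to \<open>T\<close>.\<close>

lemma torus_commute:
  assumes "torus T" "s \<in> T" "t \<in> T"
  shows "s ** t = t ** s"
proof -
  obtain I f f' where f: "alg_hom Qbar T (split_torus I :: 'a cmat set) f"
    and f': "\<And>t. t \<in> T \<Longrightarrow> f' (f t) = t"
    using assms(1) unfolding torus_def by blast
  have alg: "alg_group Qbar T"
    using assms(1) by (simp add: torus_def)
  have diag: "x ** y = y ** x" if "x \<in> split_torus I" "y \<in> split_torus I" for x y :: "'a cmat"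
  proof -
    have "x $ i $ j = 0" "y $ i $ j = 0" if "i \<noteq> j" for i j
      using \<open>x \<in> _\<close> \<open>y \<in> _\<close> that by (auto simp: split_torus_def)
    then have "x $ i $ k * y $ k $ j = y $ i $ k * x $ k $ j" for i j k
      by (cases "i = k"; cases "k = j") auto
    then show ?thesis
      by (simp add: vec_eq_iff matrix_mult_entry)
  qed
  have "f (s ** t) = f (t ** s)"
    using alg_hom_mult[OF f] diag alg_hom_closed[OF f] assms(2,3) by simp
  then show ?thesis
    using f' alg_group_mult[OF alg] assms(2,3) by metis
qed

section \<open>Cocharacters, their exponents, and density of algebraic points\<close>

lemma
  assumes "l \<in> cocharacters T"
  shows cocharacter_closed: "z \<noteq> 0 \<Longrightarrow> l z \<in> T"
    and cocharacter_mult: "z \<noteq> 0 \<Longrightarrow> w \<noteq> 0 \<Longrightarrow> l (z * w) = l z ** l w"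
    and cocharacter_laurent: "laurent_mat Qbar l"
proof -
  have hom: "alg_hom Qbar Gm T (\<lambda>A. l (A $ 1 $ 1))"
    using assms by (simp add: cocharacters_def)
  show "l z \<in> T" if "z \<noteq> 0"
    using alg_hom_closed[OF hom mat_1_in_Gm[OF that]] by (simp add: mat_1_entry)
  show "l (z * w) = l z ** l w" if "z \<noteq> 0" "w \<noteq> 0"
    using alg_hom_mult[OF hom mat_1_in_Gm[OF that(1)] mat_1_in_Gm[OF that(2)]]
    by (simp add: mat_1_entry mat_mult_mat)
  show "laurent_mat Qbar l"
    unfolding laurent_mat_def
    using regular_on_Gm_iff[OF subfield_C_Qbar, of "\<lambda>z. l z $ i $ j" for i j] alg_hom_regular[OF hom]
    by blast
qed

lemma cocharactersI:
  assumes "\<And>z. z \<noteq> 0 \<Longrightarrow> l z \<in> T"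
    and "\<And>z w. z \<noteq> 0 \<Longrightarrow> w \<noteq> 0 \<Longrightarrow> l (z * w) = l z ** l w"
    and "laurent_mat Qbar l"
  shows "l \<in> cocharacters T"
  unfolding cocharacters_def
proof (intro CollectI alg_homI)
  fix A B :: "1 cmat"
  assume "A \<in> Gm" "B \<in> Gm"
  moreover have "(A ** B) $ 1 $ 1 = A $ 1 $ 1 * B $ 1 $ 1"
    by (simp add: matrix_mult_entry)
  ultimately show "l ((A ** B) $ 1 $ 1) = l (A $ 1 $ 1) ** l (B $ 1 $ 1)"
    by (simp add: Gm_iff assms(2))
next
  show "regular_on Qbar Gm (\<lambda>A. l (A $ 1 $ 1) $ i $ j)" for i j
    using regular_on_Gm_iff[OF subfield_C_Qbar, of "\<lambda>z. l z $ i $ j"] laurent_matD[OF assms(3)]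
    by blast
qed (simp add: Gm_iff assms(1))

lemma hom_one:
  fixes l :: "complex \<Rightarrow> 'n::finite cmat"
  assumes "\<And>z w. z \<noteq> 0 \<Longrightarrow> w \<noteq> 0 \<Longrightarrow> l (z * w) = l z ** l w" "invertible (l 1)"
  shows "l 1 = mat 1"
proof -
  have "matrix_inv (l 1) ** (l 1 ** l 1) = matrix_inv (l 1) ** l 1"
    using assms(1)[of 1 1] by simp
  then show ?thesis
    by (simp add: matrix_mul_assoc matrix_inv_left[OF assms(2)])
qed

lemma laurent_mat_at:
  assumes "laurent_mat K l" "subfield_C K" "z \<in> K" "z \<noteq> 0"
  shows "entries_in K (l z)"
  unfolding entries_in_def
proof (intro allI)
  fix i j
  obtain q k where q: "\<forall>i. coeff q i \<in> K" "\<forall>z. z \<noteq> 0 \<longrightarrow> l z $ i $ j = poly q z / z ^ k"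
    using laurent_matD[OF assms(1)] unfolding laurent_def by blast
  then show "l z $ i $ j \<in> K"
    using assms(2-4) by (auto intro!: subfield_C_divide subfield_C_power subfield_C_poly)
qed

lemma power_int_2_inject: "(2 :: complex) powi k = 2 powi m \<longleftrightarrow> k = m"
proof
  assume "(2 :: complex) powi k = 2 powi m"
  then have "norm ((2 :: complex) powi k) = norm ((2 :: complex) powi m)"
    by simp
  then have "(2 :: real) powi k = 2 powi m"
    by (simp add: norm_power_int)
  then have "2 powr real_of_int k = 2 powr real_of_int m"
    by (simp add: powr_real_of_int')
  then show "k = m"
    by (simp add: powr_inj)
qed simp

text \<open>The exponent is unique because it is already determined at z = 2, an algebraic number
  whose integer powers are distinct.\<close>

lemma pairing_eq:
  assumes "\<And>z. z \<in> Qbar \<Longrightarrow> z \<noteq> 0 \<Longrightarrow> c (l z) = z powi k"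
  shows "pairing c l = k"
  unfolding pairing_def
proof (rule the_equality)
  show "\<forall>z \<in> Qbar - {0}. c (l z) = z powi k"
    using assms by simp
  fix m assume m: "\<forall>z \<in> Qbar - {0}. c (l z) = z powi m"
  have "(2 :: complex) \<in> Qbar"
    by (simp add: Qbar_def)
  then have "(2 :: complex) powi m = 2 powi k"
    using m assms[of 2] by simp
  then show "m = k"
    by (simp add: power_int_2_inject)
qed

text \<open>The new coefficients contain powers of an arbitrary complex \<open>w\<close>, possibly
  transcendental, so they lie only in \<open>UNIV\<close>.\<close>

lemma laurent_scale:
  assumes "laurent K f" "w \<noteq> 0"
  shows "laurent UNIV (\<lambda>z. f (z * w))"
proof -
  obtain q k where q: "\<forall>z. z \<noteq> 0 \<longrightarrow> f z = poly q z / z ^ k"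
    using assms(1) unfolding laurent_def by blast
  show ?thesis
    by (rule laurentI[of "smult (1 / w ^ k) (pcompose q [:0, w:])" _ _ k])
      (use q assms(2) in \<open>auto simp: poly_pcompose power_mult_distrib mult.commute\<close>)
qed

lemma subfield_C_UNIV: "subfield_C UNIV"
  by (simp add: subfield_C_def)

lemma laurent_mat_UNIV: "laurent_mat K l \<Longrightarrow> laurent_mat UNIV l"
  unfolding laurent_mat_def laurent_def by blast

lemma laurent_mat_scale: "laurent_mat K l \<Longrightarrow> w \<noteq> 0 \<Longrightarrow> laurent_mat UNIV (\<lambda>z. l (z * w))"
  unfolding laurent_mat_def using laurent_scale by blast

text \<open>The algebraic points are Zariski dense in the multiplicative group.\<close>

lemma cocharacters_densityI:
  assumes T: "alg_group \<rat> T" and l: "laurent_mat Qbar l"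
    and closed: "\<And>z. z \<in> Qbar \<Longrightarrow> z \<noteq> 0 \<Longrightarrow> l z \<in> T"
    and mult: "\<And>z w. z \<in> Qbar \<Longrightarrow> w \<in> Qbar \<Longrightarrow> z \<noteq> 0 \<Longrightarrow> w \<noteq> 0 \<Longrightarrow> l (z * w) = l z ** l w"
  shows "l \<in> cocharacters T"
proof (rule cocharactersI[OF _ _ l])
  have one: "(1 :: complex) \<in> Qbar"
    by (simp add: Qbar_def)
  have inv1: "invertible (l 1)"
    using alg_group_invertible[OF T closed[OF one]] by simp
  have "matrix_inv (l 1) ** (l 1 ** l 1) = matrix_inv (l 1) ** l 1"
    using mult[OF one one] by simp
  then have l1: "l 1 = mat 1"
    by (simp add: matrix_mul_assoc matrix_inv_left[OF inv1])
  obtain F where F: "F \<subseteq> poly_fun \<rat>" "T = {A. invertible A \<and> (\<forall>f\<in>F. f A = 0)}"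
    using alg_group_zariski_closed[OF T] unfolding zariski_closed_def by blast
  \<comment> \<open>Invertibility is not a vanishing condition and does not pass to limits by
    density. Knowing that the determinant is a power of z secures it for every nonzero z.\<close>
  obtain m where m: "\<And>z. z \<noteq> 0 \<Longrightarrow> det (l z) = z powi m"
  proof (rule laurent_hom)
    show "laurent Qbar (\<lambda>z. det (l z))"
      by (rule laurent_det[OF subfield_C_Qbar l])
  qed (auto simp: l1 mult det_mul)
  show "l z \<in> T" if z: "z \<noteq> 0" for z
  proof -
    have "f (l z) = 0" if f: "f \<in> F" for f
    proof (rule laurent_eq[of Qbar "\<lambda>z. f (l z)" Qbar "\<lambda>z. 0", OF _ _ _ z])
      have "f \<in> poly_fun Qbar"
        using F(1) f poly_fun_mono[of \<rat> Qbar] subfield_C_rat[OF subfield_C_Qbar] by blast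
      then show "laurent Qbar (\<lambda>z. f (l z))"
        by (rule laurent_poly_fun[OF subfield_C_Qbar l])
      show "laurent Qbar (\<lambda>z. 0)"
        by (intro laurent_const subfield_C_Qbar subfield_C_0)
      show "f (l z) = 0" if "z \<in> Qbar" "z \<noteq> 0" for z
        using closed[OF that] f F(2) by blast
    qed
    moreover have "invertible (l z)"
      using m[OF z] z by (simp add: invertible_det_nz)
    ultimately show ?thesis
      using F(2) by blast
  qed
  have lU: "laurent_mat UNIV l"
    using l by (rule laurent_mat_UNIV)
  have right: "laurent_mat UNIV (\<lambda>z. l z ** l w)" for w
    by (intro laurent_mat_mult[OF subfield_C_UNIV] lU laurent_mat_const[OF subfield_C_UNIV])
      (simp add: entries_in_def)
  have left: "laurent_mat UNIV (\<lambda>z. l w ** l z)" for w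
    by (intro laurent_mat_mult[OF subfield_C_UNIV] lU laurent_mat_const[OF subfield_C_UNIV])
      (simp add: entries_in_def)
  \<comment> \<open>Density is applied in one variable at a time: first in \<open>z\<close> for
    algebraic \<open>w\<close>, then in \<open>w\<close> for arbitrary \<open>z\<close>.\<close>
  have half: "l (z * w) = l z ** l w" if "z \<noteq> 0" "w \<in> Qbar" "w \<noteq> 0" for z w
    using laurent_mat_eq[OF laurent_mat_scale[OF l that(3)] right[of w] _ that(1)] mult that by blast
  show "l (z * w) = l z ** l w" if "z \<noteq> 0" "w \<noteq> 0" for z w
  proof -
    have "l (w * z) = l z ** l w"
      using half[OF that(1)]
      by (intro laurent_mat_eq[OF laurent_mat_scale[OF l that(1)] left[of z] _ that(2)])
        (simp add: mult.commute)
    then show ?thesis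
      by (simp add: mult.commute)
  qed
qed


section \<open>Idempotents and traces\<close>

lemma trace_mat_mult: "trace ((mat c :: 'n::finite cmat) ** A) = c * trace A"
  by (simp add: trace_def mat_mult_entry sum_distrib_left)

lemma mat_mult_commute: "(mat c :: 'n::finite cmat) ** A = A ** mat c"
  by (simp add: vec_eq_iff mat_mult_entry)
    (simp add: matrix_mult_entry mat_def if_distrib[of "(*) _"] mult.commute cong: if_cong)

lemma mat_vector_mult: "((mat c :: 'n::finite cmat) ** A) *v v = c *s (A *v v)"
  by (simp add: vec_eq_iff matrix_vector_mult_def mat_mult_entry sum_distrib_left mult.assoc)

lemma
  fixes A B C :: "'n::finite cmat"
  shows matrix_add_right_distrib: "(A + B) ** C = A ** C + B ** C"
    and matrix_diff_right_distrib: "(A - B) ** C = A ** C - B ** C"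
    and matrix_diff_left_distrib: "C ** (A - B) = C ** A - C ** B"
  by (simp_all add: vec_eq_iff matrix_mult_entry algebra_simps sum.distrib sum_subtractf)

text \<open>For \<open>P\<close> idempotent and \<open>A\<close> commuting with it, this is
  \<open>A\<close> on the image of \<open>P\<close> and the identity on the kernel. Its determinant
  is that of \<open>A\<close> on the image, and for \<open>A = mat z\<close> it is the cocharacter
  with weight 1 on the image and weight 0 on the kernel.\<close>

definition on_image :: "'n::finite cmat \<Rightarrow> 'n cmat \<Rightarrow> 'n cmat" where
  "on_image P A = A ** P + (mat 1 - P)"

lemma on_image_mult:
  assumes "P ** P = P" "B ** P = P ** B"
  shows "on_image P (A ** B) = on_image P A ** on_image P B"
proof -
  have 1: "A ** P ** (B ** P) = A ** B ** P"
  proof -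
    have "A ** P ** (B ** P) = A ** (P ** B) ** P"
      by (simp add: matrix_mul_assoc)
    also have "\<dots> = A ** B ** (P ** P)"
      by (simp add: assms(2)[symmetric] matrix_mul_assoc)
    finally show ?thesis
      by (simp add: assms(1))
  qed
  have 2: "A ** P ** (mat 1 - P) = 0"
    by (simp add: matrix_diff_left_distrib matrix_mul_assoc[symmetric] assms(1))
  have 3: "(mat 1 - P) ** (B ** P) = 0"
    by (simp add: matrix_diff_right_distrib assms(2) matrix_mul_assoc assms(1))
  have 4: "(mat 1 - P) ** (mat 1 - P) = mat 1 - P"
    by (simp add: matrix_diff_left_distrib matrix_diff_right_distrib assms(1))
  show ?thesis
    by (simp add: on_image_def matrix_add_ldistrib matrix_add_right_distrib 1 2 3 4)
qed

lemma on_image_one [simp]: "on_image P (mat 1) = mat 1"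
  by (simp add: on_image_def)

lemma on_image_conj:
  fixes M :: "'n::finite cmat"
  assumes "invertible M"
  shows "on_image P (M ** A ** matrix_inv M) =
    M ** on_image (matrix_inv M ** P ** M) A ** matrix_inv M"
proof -
  have "M ** on_image (matrix_inv M ** P ** M) A ** matrix_inv M =
    M ** A ** matrix_inv M ** P ** (M ** matrix_inv M) +
      ((M ** matrix_inv M) - (M ** matrix_inv M) ** P ** (M ** matrix_inv M))"
    by (simp add: on_image_def matrix_add_ldistrib matrix_add_right_distrib matrix_diff_left_distrib
        matrix_diff_right_distrib matrix_mul_assoc)
  also have "\<dots> = on_image P (M ** A ** matrix_inv M)"
    by (simp add: matrix_inv_right[OF assms] on_image_def)
  finally show ?thesis ..
qed

lemma det_conj:
  fixes M A :: "'n::finite cmat"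
  assumes "invertible M"
  shows "det (M ** A ** matrix_inv M) = det A"
proof -
  have "det M * det (matrix_inv M) = 1"
    using arg_cong[OF matrix_inv_right[OF assms], of det] by (simp add: det_mul)
  then show ?thesis
    by (simp add: det_mul mult.commute mult.left_commute)
qed

lemma trace_conj:
  fixes M A :: "'n::finite cmat"
  assumes "invertible M"
  shows "trace (M ** A ** matrix_inv M) = trace A"
proof -
  have "trace (M ** A ** matrix_inv M) = trace (matrix_inv M ** (M ** A))"
    by (rule trace_mul_sym)
  then show ?thesis
    by (simp add: matrix_mul_assoc matrix_inv_left[OF assms])
qed

text \<open>The homomorphism cut down to the image of \<open>P\<close> has derivative
  \<open>N ** P\<close> at 1, so the exponent of its determinant is the trace of \<open>N\<close> on
  that image.\<close>

lemma det_on_image_hom: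
  fixes R :: "complex \<Rightarrow> 'n::finite cmat"
  assumes R: "laurent_mat K R" and K: "subfield_C K" and N: "mat_deriv R N" and R1: "R 1 = mat 1"
    and mult: "\<And>z w. z \<noteq> 0 \<Longrightarrow> w \<noteq> 0 \<Longrightarrow> R (z * w) = R z ** R w"
    and P: "P ** P = P" "entries_in K P" "\<And>z. z \<noteq> 0 \<Longrightarrow> R z ** P = P ** R z"
  obtains m :: int where "trace (N ** P) = of_int m" "\<And>z. z \<noteq> 0 \<Longrightarrow> det (on_image P (R z)) = z powi m"
proof (rule det_hom_eq_power[OF _ K])
  show "laurent_mat K (\<lambda>z. on_image P (R z))"
    unfolding on_image_def
    by (intro laurent_mat_add[OF K] laurent_mat_mult[OF K] R laurent_mat_const[OF K] P(2)
        entries_in_diff[OF K] entries_in_mat[OF K] subfield_C_1[OF K])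
  show "mat_deriv (\<lambda>z. on_image P (R z)) (N ** P)"
    using mat_deriv_add[OF mat_deriv_mult[OF N mat_deriv_const] mat_deriv_const, of P "mat 1 - P"]
    by (simp add: on_image_def)
qed (auto simp: R1 mult on_image_mult[OF P(1) P(3)] intro: that)

text \<open>The trace form is invariant under \<open>M\<close>, which acts on \<open>N\<close> by \<open>-1\<close>; in a root datum this is
  the identity \<open>2 (l, b) = \<langle>a, l\<rangle> (b, b)\<close> for an invariant form and a coroot \<open>b\<close> of \<open>a\<close>.\<close>

lemma reflection_trace:
  fixes M D N :: "'n::finite cmat"
  assumes M: "invertible M" and N: "M ** N ** matrix_inv M = N + mat (- 2) ** N"
    and D: "M ** D ** matrix_inv M = D + mat (- k) ** N"
  shows "2 * trace (D ** N) = k * trace (N ** N)"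
proof -
  have "trace (D ** N) = trace (M ** (D ** N) ** matrix_inv M)"
    by (rule trace_conj[OF M, symmetric])
  also have "M ** (D ** N) ** matrix_inv M = (M ** D ** matrix_inv M) ** (M ** N ** matrix_inv M)"
  proof -
    have "(M ** D ** matrix_inv M) ** (M ** N ** matrix_inv M) =
        M ** D ** (matrix_inv M ** M) ** N ** matrix_inv M"
      by (simp only: matrix_mul_assoc)
    then show ?thesis
      by (simp add: matrix_inv_left[OF M] matrix_mul_assoc)
  qed
  also have "\<dots> = (D + mat (- k) ** N) ** (mat (- 1) ** N)"
    unfolding N D by (simp add: vec_eq_iff matrix_mult_entry[of "D + mat (- k) ** N"] mat_mult_entry)
  also have "\<dots> = mat (- 1) ** ((D + mat (- k) ** N) ** N)"
    by (simp only: matrix_mul_assoc mat_mult_commute[of "- 1" "D + mat (- k) ** N"])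
  also have "trace \<dots> = - trace (D ** N) + k * trace (N ** N)"
    by (simp add: trace_mat_mult matrix_add_right_distrib trace_add matrix_mul_assoc[symmetric])
  finally show ?thesis
    by simp
qed


section \<open>The Hodge character\<close>

lemma exists_nontrivial_root_of_unity:
  assumes "k \<notin> {-1, 0, 1 :: int}"
  shows "\<exists>z :: complex. z \<noteq> 1 \<and> z \<noteq> 0 \<and> z powi k = 1"
proof -
  define n where "n = nat \<bar>k\<bar>"
  have "n > 1"
    using assms by (auto simp: n_def)
  then have "card {z :: complex. z ^ n = 1} = n"
    by (intro card_roots_unity_eq) auto
  then have "\<not> {z :: complex. z ^ n = 1} \<subseteq> {1}"
    using card_mono[of "{1 :: complex}" "{z. z ^ n = 1}"] \<open>n > 1\<close> by auto
  then obtain z :: complex where z: "z ^ n = 1" "z \<noteq> 1"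
    by blast
  moreover have "z \<noteq> 0"
    using z \<open>n > 1\<close> by (auto simp: power_0_left)
  moreover have "z powi k = 1"
    using z(1) by (auto simp: power_int_def n_def power_inverse abs_if split: if_splits)
  ultimately show ?thesis
    by blast
qed

lemma exists_root_power_int:
  assumes "k \<noteq> (0 :: int)" "w \<noteq> 0"
  shows "\<exists>z :: complex. z \<noteq> 0 \<and> z powi k = w"
proof (intro exI conjI)
  show "exp (Ln w / of_int k) \<noteq> 0"
    by simp
  show "exp (Ln w / of_int k) powi k = w"
    using assms exp_power_int[of "Ln w / of_int k" k] by simp
qed

text \<open>At z = 2 a vector x + y goes to 2 x + y, so subtracting the identity leaves the
  projection to weight 1. The choice of an algebraic argument later gives this projection algebraic
  entries.\<close>

lemma weights_zero_one:
  fixes R :: "complex \<Rightarrow> 'n::finite cmat"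
  assumes "\<And>v. \<exists>x y. v = x + y \<and> (\<forall>z. z \<noteq> 0 \<longrightarrow> R z *v x = z *s x \<and> R z *v y = y)"
    and P: "P = R 2 - mat 1"
  shows "P ** P = P" and "z \<noteq> 0 \<Longrightarrow> R z = on_image P (mat z)"
proof -
  have dec: "\<exists>x y. v = x + y \<and> P *v v = x \<and> P *v x = x \<and> (\<forall>z. z \<noteq> 0 \<longrightarrow> R z *v v = z *s x + y)" for v
  proof -
    obtain x y where v: "v = x + y" and xy: "\<And>z. z \<noteq> 0 \<Longrightarrow> R z *v x = z *s x \<and> R z *v y = y"
      using assms(1) by blast
    have R2: "R 2 *v x = x + x" "R 2 *v y = y"
      using xy[of 2] by (simp_all add: vec_eq_iff)
    have "P *v x = x"
      by (simp add: P matrix_vector_mult_diff_rdistrib R2)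
    moreover have "P *v v = x"
      by (simp add: v P matrix_vector_mult_diff_rdistrib matrix_vector_right_distrib R2)
    moreover have "\<forall>z. z \<noteq> 0 \<longrightarrow> R z *v v = z *s x + y"
      using xy by (simp add: v matrix_vector_right_distrib)
    ultimately show ?thesis
      using v by (intro exI[of _ x] exI[of _ y]) simp
  qed
  have PP: "P *v (P *v v) = P *v v" for v
    using dec[of v] by auto
  then show "P ** P = P"
    by (simp add: matrix_eq matrix_vector_mul_assoc[symmetric])
  show "R z = on_image P (mat z)" if z: "z \<noteq> 0"
    unfolding matrix_eq
  proof
    fix v
    obtain x y where xy: "v = x + y" "P *v v = x" and R: "R z *v v = z *s x + y"
      using dec[of v] z by auto
    have "on_image P (mat z) *v v = z *s x + (v - x)"
      by (simp add: on_image_def matrix_vector_mult_add_rdistrib matrix_vector_mult_diff_rdistrib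
          mat_vector_mult xy(2))
    also have "v - x = y"
      using xy(1) by simp
    finally show "R z *v v = on_image P (mat z) *v v"
      using R by simp
  qed
qed

lemma on_image_mat_deriv: "mat_deriv (\<lambda>z. on_image P (mat z)) P"
  using mat_deriv_add[OF mat_deriv_mult[OF mat_deriv_scalar mat_deriv_const] mat_deriv_const,
      of P "mat 1 - P"]
  by (simp add: on_image_def)

lemma on_image_mat_eq_iff:
  fixes P Q :: "'n::finite cmat"
  assumes "on_image P (mat z) = on_image Q (mat z)" "z \<noteq> 1"
  shows "P = Q"
proof -
  have "z * P $ i $ j - P $ i $ j = z * Q $ i $ j - Q $ i $ j" for i j
    using arg_cong[OF assms(1), of "\<lambda>A. A $ i $ j"] by (simp add: on_image_def mat_mult_entry)
  then have "(z - 1) * (P $ i $ j - Q $ i $ j) = 0" for i j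
    by (simp add: algebra_simps)
  then show ?thesis
    using assms(2) by (simp add: vec_eq_iff)
qed

text \<open>The Hodge-theoretic input is condensed into \<open>P\<close>, the projection to the
  weight 1 part of \<mu> on V along the weight 0 part.\<close>

locale hodge_embedding =
  fixes G T :: "'m::finite cmat set" and H :: "'v::finite cmat set"
    and \<psi> :: "'m cmat \<Rightarrow> 'v cmat" and \<mu> :: "complex \<Rightarrow> 'm cmat" and P :: "'v cmat"
  assumes G: "alg_group \<rat> G" and T: "alg_group \<rat> T" and TG: "T \<subseteq> G"
    and T_commute: "\<And>s t. s \<in> T \<Longrightarrow> t \<in> T \<Longrightarrow> s ** t = t ** s"
    and \<psi>: "alg_hom \<rat> G H \<psi>" and H: "\<And>A. A \<in> H \<Longrightarrow> invertible A" and \<psi>_inj: "inj_on \<psi> G"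
    and \<mu>: "\<mu> \<in> cocharacters T"
    and P_idem: "P ** P = P" and \<psi>\<mu>: "\<And>z. z \<noteq> 0 \<Longrightarrow> \<psi> (\<mu> z) = on_image P (mat z)"
begin

section \<open>The representation \<psi> on inverses, Galois conjugates and cocharacters\<close>

lemma in_G: "t \<in> T \<Longrightarrow> t \<in> G"
  using TG by blast

lemma \<psi>_invertible: "g \<in> G \<Longrightarrow> invertible (\<psi> g)"
  using H alg_hom_closed[OF \<psi>] by blast

lemmas \<psi>_mult = alg_hom_mult[OF \<psi>]
lemmas G_inv = alg_group_inv[OF G]

lemma \<psi>_one: "\<psi> (mat 1) = mat 1"
proof -
  have one: "mat 1 \<in> G"
    by (rule alg_group_one[OF G])
  have "matrix_inv (\<psi> (mat 1)) ** (\<psi> (mat 1) ** \<psi> (mat 1)) = matrix_inv (\<psi> (mat 1)) ** \<psi> (mat 1)"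
    using \<psi>_mult[OF one one] by simp
  then show ?thesis
    by (simp add: matrix_mul_assoc matrix_inv_left[OF \<psi>_invertible[OF one]])
qed

lemma \<psi>_inv:
  assumes g: "g \<in> G" shows "\<psi> (matrix_inv g) = matrix_inv (\<psi> g)"
proof (rule matrix_inv_unique[symmetric])
  show "\<psi> g ** \<psi> (matrix_inv g) = mat 1"
    using \<psi>_mult[OF g G_inv[OF g]] matrix_inv_right[OF alg_group_invertible[OF G g]] \<psi>_one by simp
qed

lemma \<psi>_conj: "n \<in> G \<Longrightarrow> g \<in> G \<Longrightarrow> \<psi> (conj_by n g) = \<psi> n ** \<psi> g ** matrix_inv (\<psi> n)"
  by (simp add: conj_by_def \<psi>_mult \<psi>_inv G_inv alg_group_mult[OF G])

lemma Rats_subset_Qbar: "\<rat> \<subseteq> Qbar"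
  using subfield_C_Qbar by (simp add: subfield_C_def)

lemma \<psi>_regular_Qbar: "regular_on Qbar T (\<lambda>g. \<psi> g $ i $ j)"
  by (rule regular_on_mono[OF alg_hom_regular[OF \<psi>] Rats_subset_Qbar TG])

lemma \<psi>_entries: "g \<in> G \<Longrightarrow> entries_in Qbar g \<Longrightarrow> entries_in Qbar (\<psi> g)"
  unfolding entries_in_def[of Qbar "\<psi> g"]
  by (intro allI regular_on_in_field[OF subfield_C_Qbar
        regular_on_mono[OF alg_hom_regular[OF \<psi>] Rats_subset_Qbar subset_refl]])

text \<open>The Galois conjugate stays in G, so the rational formula for \<psi> applies at both
  points and is equivariant.\<close>

lemma \<psi>_galois:
  assumes "s \<in> Gal_Qbar" "g \<in> G" "entries_in Qbar g"
  shows "\<psi> (map_matrix s g) = map_matrix s (\<psi> g)"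
proof -
  interpret galois s
    using assms(1) by unfold_locales
  have "map_matrix s g \<in> G"
    using zariski_closed_stable[OF alg_group_zariski_closed[OF G]] assms(2,3) by blast
  then show ?thesis
    using regular_on_equivariant[OF alg_hom_regular[OF \<psi>]] assms(2,3) by (simp add: vec_eq_iff)
qed

lemma cochar_one: "l \<in> cocharacters T \<Longrightarrow> l 1 = mat 1"
  by (rule hom_one) (auto simp: cocharacter_mult intro!: alg_group_invertible[OF T] cocharacter_closed)

lemma \<psi>_cochar_mult:
  "l \<in> cocharacters T \<Longrightarrow> z \<noteq> 0 \<Longrightarrow> w \<noteq> 0 \<Longrightarrow> \<psi> (l (z * w)) = \<psi> (l z) ** \<psi> (l w)"
  by (simp add: cocharacter_mult \<psi>_mult in_G cocharacter_closed)

text \<open>The denominator of a regular function is a power of the determinant, and along a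
  cocharacter the determinant is a power of z.\<close>

lemma \<psi>_cochar_laurent:
  assumes l: "l \<in> cocharacters T"
  shows "laurent_mat Qbar (\<lambda>z. \<psi> (l z))"
  unfolding laurent_mat_def
proof (intro allI)
  fix i j
  have lm: "laurent_mat Qbar l"
    by (rule cocharacter_laurent[OF l])
  obtain p k where p: "p \<in> poly_fun Qbar" "\<forall>g\<in>T. \<psi> g $ i $ j = p g / det g ^ k"
    using \<psi>_regular_Qbar unfolding regular_on_def by blast
  obtain m where m: "\<And>z. z \<noteq> 0 \<Longrightarrow> det (l z) = z powi m"
    using laurent_hom[OF laurent_det[OF subfield_C_Qbar lm]] cochar_one[OF l] cocharacter_mult[OF l]
    by (auto simp: det_mul)
  have "laurent Qbar (\<lambda>z. p (l z) * (z powi (- m)) ^ k)"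
    by (intro laurent_mult laurent_power laurent_power_int laurent_poly_fun[OF subfield_C_Qbar lm p(1)]
        subfield_C_Qbar)
  moreover have "\<psi> (l z) $ i $ j = p (l z) * (z powi (- m)) ^ k" if "z \<noteq> 0" for z
    using p(2) cocharacter_closed[OF l that] m[OF that]
    by (simp add: power_int_minus power_inverse divide_inverse)
  ultimately show "laurent Qbar (\<lambda>z. \<psi> (l z) $ i $ j)"
    using laurent_cong[of "\<lambda>z. \<psi> (l z) $ i $ j" "\<lambda>z. p (l z) * (z powi (- m)) ^ k" Qbar] by blast
qed

lemma cochar_points: "l \<in> cocharacters T \<Longrightarrow> z \<in> Qbar \<Longrightarrow> z \<noteq> 0 \<Longrightarrow> entries_in Qbar (l z)"
  using laurent_mat_at[OF cocharacter_laurent subfield_C_Qbar] by blast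

lemma two_Qbar: "(2 :: complex) \<in> Qbar" "(2 :: complex) \<noteq> 0"
  by (auto simp: Qbar_def)

lemma on_image_two: "on_image A (mat 2) - mat 1 = A"
  by (simp add: on_image_def vec_eq_iff mat_mult_entry)

lemma P_eq: "P = \<psi> (\<mu> 2) - mat 1"
  by (simp add: \<psi>\<mu> on_image_two)

text \<open>Evaluation at 2 expresses \<open>A\<close> as \<psi> of an algebraic point of T minus
  the identity. Stated for general \<open>x\<close> because it serves both \<mu> and its Weyl-Galois
  transports.\<close>

lemma weight_projection:
  assumes x: "x \<in> cocharacters T" and \<psi>x: "\<And>z. z \<noteq> 0 \<Longrightarrow> \<psi> (x z) = on_image A (mat z)"
  shows "entries_in Qbar A" and "t \<in> T \<Longrightarrow> \<psi> t ** A = A ** \<psi> t"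
proof -
  have A: "A = \<psi> (x 2) - mat 1"
    by (simp add: \<psi>x on_image_two)
  have x2: "x 2 \<in> T"
    by (simp add: cocharacter_closed[OF x])
  show "entries_in Qbar A"
    unfolding A using cochar_points[OF x two_Qbar]
    by (intro entries_in_diff entries_in_mat \<psi>_entries in_G x2 subfield_C_Qbar subfield_C_1)
  show "\<psi> t ** A = A ** \<psi> t" if "t \<in> T"
  proof -
    have "\<psi> t ** \<psi> (x 2) = \<psi> (x 2) ** \<psi> t"
      using \<psi>_mult[OF in_G[OF that] in_G[OF x2]] \<psi>_mult[OF in_G[OF x2] in_G[OF that]]
        T_commute[OF that x2] by simp
    then show ?thesis
      by (simp add: A matrix_diff_left_distrib matrix_diff_right_distrib)
  qed
qed

lemma P_Qbar: "entries_in Qbar P" and P_commute: "t \<in> T \<Longrightarrow> \<psi> t ** P = P ** \<psi> t"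
  using weight_projection[OF \<mu> \<psi>\<mu>] by auto

text \<open>The Hodge character on \<open>T\<close>, with the determinant on a subspace replaced by
  one on all of V; \<open>hodge_character_eq\<close> proves the agreement.\<close>

definition "\<eta> t = inverse (det (on_image P (\<psi> t)))"

lemma \<eta>_mult:
  assumes "s \<in> T" "t \<in> T" shows "\<eta> (s ** t) = \<eta> s * \<eta> t"
  using on_image_mult[OF P_idem P_commute[OF assms(2)], of "\<psi> s"] assms
  by (simp add: \<eta>_def \<psi>_mult in_G det_mul)

lemma \<eta>_inv:
  assumes t: "t \<in> T"
  shows "det (on_image P (\<psi> t)) * det (on_image P (\<psi> (matrix_inv t))) = 1"
proof -
  have t': "matrix_inv t \<in> T"
    by (rule alg_group_inv[OF T t])
  have "on_image P (\<psi> t) ** on_image P (\<psi> (matrix_inv t)) = on_image P (\<psi> (t ** matrix_inv t))"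
    using on_image_mult[OF P_idem P_commute[OF t']] t t' by (simp add: \<psi>_mult in_G)
  also have "\<dots> = mat 1"
    by (simp add: matrix_inv_right[OF alg_group_invertible[OF T t]] \<psi>_one)
  finally show ?thesis
    by (metis det_mul det_I)
qed

text \<open>The inverse of the determinant equals the same determinant at the inverse element, which
  is regular because inversion is.\<close>

lemma \<eta>_character: "\<eta> \<in> characters T"
  unfolding characters_def
proof (intro CollectI alg_homI)
  fix t assume "t \<in> T"
  then have "\<eta> t \<noteq> 0"
    using \<eta>_inv[of t] by (auto simp: \<eta>_def)
  then show "(mat (\<eta> t) :: 1 cmat) \<in> Gm"
    by (rule mat_1_in_Gm)
next
  fix s t assume "s \<in> T" "t \<in> T"
  then show "(mat (\<eta> (s ** t)) :: 1 cmat) = mat (\<eta> s) ** mat (\<eta> t)"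
    by (simp add: \<eta>_mult mat_mult_mat)
next
  fix i j :: 1
  have inv: "\<And>g. g \<in> T \<Longrightarrow> invertible g"
    by (rule alg_group_invertible[OF T])
  have "regular_on Qbar T (\<lambda>g. det (on_image P (\<psi> g)))"
  proof (intro regular_on_det_comp[OF subfield_C_Qbar] inv)
    fix i j
    have "entries_in Qbar (mat 1 - P)"
      by (intro entries_in_diff entries_in_mat P_Qbar subfield_C_Qbar subfield_C_1)
    then have "regular_on Qbar T (\<lambda>g. (\<Sum>k\<in>UNIV. \<psi> g $ i $ k * P $ k $ j) + (mat 1 - P) $ i $ j)"
      using P_Qbar
      by (intro regular_on_add regular_on_sum regular_on_mult regular_on_const \<psi>_regular_Qbar
          subfield_C_Qbar inv entries_inD)
    then show "regular_on Qbar T (\<lambda>g. on_image P (\<psi> g) $ i $ j)"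
      by (simp add: on_image_def matrix_mult_entry)
  qed
  from regular_on_matrix_inv[OF subfield_C_Qbar inv alg_group_inv[OF T] this]
  have "regular_on Qbar T (\<lambda>g. det (on_image P (\<psi> (matrix_inv g))))"
    by blast
  moreover have "det (on_image P (\<psi> (matrix_inv g))) = (mat (\<eta> g) :: 1 cmat) $ i $ j" if "g \<in> T" for g
    using \<eta>_inv[OF that] inverse_unique[of "det (on_image P (\<psi> g))"]
    by (simp add: \<eta>_def mat_def num1_eqI[of i j])
  ultimately show "regular_on Qbar T (\<lambda>g. (mat (\<eta> g) :: 1 cmat) $ i $ j)"
    unfolding regular_on_def by simp
qed

lemma det_cochar:
  assumes b: "b \<in> cocharacters T" and N: "mat_deriv (\<lambda>z. \<psi> (b z)) N"
    and x: "x \<in> cocharacters T" "\<And>z. z \<noteq> 0 \<Longrightarrow> \<psi> (x z) = on_image A (mat z)" and A: "A ** A = A"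
  obtains m :: int where "trace (N ** A) = of_int m"
    "\<And>z. z \<noteq> 0 \<Longrightarrow> det (on_image A (\<psi> (b z))) = z powi m"
proof (rule det_on_image_hom[OF \<psi>_cochar_laurent[OF b] subfield_C_Qbar N _ _ A])
  show "\<psi> (b 1) = mat 1"
    by (simp add: cochar_one[OF b] \<psi>_one)
  show "entries_in Qbar A"
    by (rule weight_projection(1)[OF x])
  show "\<psi> (b z) ** A = A ** \<psi> (b z)" if "z \<noteq> 0" for z
    by (rule weight_projection(2)[OF x cocharacter_closed[OF b that]])
qed (auto simp: \<psi>_cochar_mult[OF b] intro: that)

lemma pairing_\<eta>:
  assumes b: "b \<in> cocharacters T" and N: "mat_deriv (\<lambda>z. \<psi> (b z)) N"
  shows "of_int (pairing \<eta> b) = - trace (N ** P)"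
proof -
  obtain m where m: "trace (N ** P) = of_int m"
    "\<And>z. z \<noteq> 0 \<Longrightarrow> det (on_image P (\<psi> (b z))) = z powi m"
    using det_cochar[OF b N \<mu> \<psi>\<mu> P_idem] by blast
  have "pairing \<eta> b = - m"
    by (rule pairing_eq) (simp add: \<eta>_def m(2) power_int_minus)
  then show ?thesis
    using m(1) by simp
qed

text \<open>Transporting \<open>\<mu>\<close> by the inverse of a Weyl-Galois element moves the element from the coroot to
  the projection \<open>P\<close>.\<close>

lemma weyl_galois_transport:
  assumes n: "n \<in> points Qbar (normalizer (mgroup G) T)" and s: "s \<in> Gal_Qbar"
  obtains x A where "x \<in> cocharacters T" "\<And>z. z \<noteq> 0 \<Longrightarrow> \<psi> (x z) = on_image A (mat z)" "A ** A = A"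
    "\<And>b N. b \<in> cocharacters T \<Longrightarrow> mat_deriv (\<lambda>z. \<psi> (b z)) N \<Longrightarrow>
      of_int (pairing \<eta> (weyl_galois_act n s b)) = - trace (N ** A)"
proof -
  interpret galois s
    using s by unfold_locales
  interpret inv: galois s_inv
    by (rule galois_s_inv)
  have nN: "n \<in> normalizer (mgroup G) T" and nQ: "entries_in Qbar n"
    using n by (auto simp: points_def entries_in_def)
  note nG = normalizer_in_group[OF G nN TG]
  have n_inv: "invertible n"
    by (rule alg_group_invertible[OF G nG])
  define M where "M = \<psi> n"
  have M: "invertible M" "entries_in Qbar M"
    unfolding M_def using \<psi>_invertible[OF nG] \<psi>_entries[OF nG nQ] by auto
  have \<psi>n': "\<psi> (matrix_inv n) = matrix_inv M"
    by (simp add: M_def \<psi>_inv[OF nG])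
  have M': "entries_in Qbar (matrix_inv M)"
    by (rule entries_in_matrix_inv[OF subfield_C_Qbar M])
  \<comment> \<open>The inverse of w s first undoes w, by conjugating with the inverse of
    \<open>n\<close>, and then applies the inverse of \<open>s\<close>.\<close>
  let ?y = "\<lambda>z. matrix_inv n ** \<mu> z ** n"
  have yT: "?y z \<in> T" if "z \<noteq> 0" for z
    using normalizer_conj_inv[OF G nN TG cocharacter_closed[OF \<mu> that]] .
  have y: "laurent_mat Qbar ?y"
    by (intro laurent_mat_mult[OF subfield_C_Qbar] laurent_mat_const[OF subfield_C_Qbar]
        cocharacter_laurent[OF \<mu>] nQ entries_in_matrix_inv[OF subfield_C_Qbar n_inv nQ])
  have yQ: "entries_in Qbar (?y z)" if "z \<in> Qbar" "z \<noteq> 0" for z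
    using laurent_mat_at[OF y subfield_C_Qbar that] .
  have y_mult: "?y (z * w) = ?y z ** ?y w" if "z \<noteq> 0" "w \<noteq> 0" for z w
  proof -
    have "?y z ** ?y w = matrix_inv n ** \<mu> z ** (n ** matrix_inv n) ** \<mu> w ** n"
      by (simp only: matrix_mul_assoc)
    then show ?thesis
      by (simp add: matrix_inv_right[OF n_inv] cocharacter_mult[OF \<mu> that] matrix_mul_assoc)
  qed
  \<comment> \<open>The Galois twist makes sense on algebraic points only; \<open>x\<close> is the
    Laurent matrix that interpolates it, and density makes it a cocharacter below.\<close>
  obtain x where x: "laurent_mat Qbar x"
    and x_eq: "\<And>z. z \<in> Qbar \<Longrightarrow> z \<noteq> 0 \<Longrightarrow> x (s_inv z) = map_matrix s_inv (?y z)"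
    using inv.laurent_mat_twist[OF y] by blast
  have x_at: "x z = map_matrix s_inv (?y (s z))" if "z \<in> Qbar" "z \<noteq> 0" for z
    using x_eq[of "s z"] that by (simp add: closed s_inv_s eq_0_iff)
  have x_cochar: "x \<in> cocharacters T"
  proof (rule cocharacters_densityI[OF T x])
    show "x z \<in> T" if "z \<in> Qbar" "z \<noteq> 0" for z
      unfolding x_at[OF that] using that
      by (intro inv.zariski_closed_stable[OF alg_group_zariski_closed[OF T]] yT yQ)
        (auto simp: closed eq_0_iff)
    show "x (z * w) = x z ** x w" if "z \<in> Qbar" "w \<in> Qbar" "z \<noteq> 0" "w \<noteq> 0" for z w
    proof -
      have "x (z * w) = map_matrix s_inv (?y (s z * s w))"
        using that x_at[of "z * w"] by (simp only: mult Qbar_closed) simp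
      also have "\<dots> = map_matrix s_inv (?y (s z)) ** map_matrix s_inv (?y (s w))"
        using that
        by (subst y_mult) (auto intro!: inv.map_matrix_mult yQ simp: closed eq_0_iff)
      finally show ?thesis
        by (simp only: x_at[OF that(1,3)] x_at[OF that(2,4)])
    qed
  qed
  \<comment> \<open>\<open>P\<close> is carried along the same two steps as \<mu>, so that
    \<open>A\<close> becomes the projection belonging to \<open>x\<close>.\<close>
  define P' where "P' = matrix_inv M ** P ** M"
  define A where "A = map_matrix s_inv P'"
  have P': "entries_in Qbar P'"
    unfolding P'_def by (intro entries_in_mult subfield_C_Qbar M' M(2) P_Qbar)
  have "P' ** P' = matrix_inv M ** P ** (M ** matrix_inv M) ** P ** M"
    by (simp only: P'_def matrix_mul_assoc)
  also have "\<dots> = matrix_inv M ** (P ** P) ** M"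
    by (simp add: matrix_inv_right[OF M(1)] matrix_mul_assoc)
  finally have P'_idem: "P' ** P' = P'"
    by (simp add: P_idem P'_def)
  have A_idem: "A ** A = A"
    unfolding A_def inv.map_matrix_mult[OF P' P', symmetric] P'_idem ..
  have AQ: "entries_in Qbar A"
    unfolding A_def by (rule inv.entries_in_map[OF P'])
  have sA: "map_matrix s A = P'"
    using P' by (simp add: A_def vec_eq_iff entries_in_def s_s_inv)
  have one_Qbar: "entries_in Qbar (mat 1)"
    by (rule entries_in_mat[OF subfield_C_Qbar subfield_C_1[OF subfield_C_Qbar]])
  have mat_Qbar: "entries_in Qbar (mat z)" if "z \<in> Qbar" for z
    by (rule entries_in_mat[OF subfield_C_Qbar that])
  have \<psi>y: "\<psi> (?y z) = on_image P' (mat z)" if "z \<noteq> 0" for z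
  proof -
    have "\<psi> (?y z) = matrix_inv M ** on_image P (mat z) ** M"
      using nG cocharacter_closed[OF \<mu> that] that
      by (simp add: \<psi>_mult in_G G_inv alg_group_mult[OF G] \<psi>n' \<psi>\<mu> M_def[symmetric])
    also have "\<dots> = mat z ** matrix_inv M ** P ** M + (matrix_inv M ** M - matrix_inv M ** P ** M)"
      by (simp add: on_image_def matrix_add_ldistrib matrix_add_right_distrib matrix_diff_left_distrib
          matrix_diff_right_distrib matrix_mul_assoc mat_mult_commute[of z "matrix_inv M"])
    finally show ?thesis
      by (simp add: on_image_def P'_def matrix_inv_left[OF M(1)] matrix_mul_assoc)
  qed
  have map_on_image: "map_matrix s (on_image A B) = on_image P' (map_matrix s B)"
    if "entries_in Qbar B" for B
  proof -
    have "map_matrix s (on_image A B) = map_matrix s (B ** A) + map_matrix s (mat 1 - A)"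
      unfolding on_image_def
      by (intro map_matrix_add entries_in_mult entries_in_diff that AQ one_Qbar subfield_C_Qbar)
    then show ?thesis
      by (simp add: map_matrix_mult[OF that AQ] map_matrix_diff[OF one_Qbar AQ] map_matrix_mat sA
          on_image_def)
  qed
  have \<psi>x_Qbar: "\<psi> (x z) = on_image A (mat z)" if z: "z \<in> Qbar" "z \<noteq> 0" for z
  proof -
    have sz: "s z \<in> Qbar" "s z \<noteq> 0"
      using z by (auto simp: closed eq_0_iff)
    have "\<psi> (x z) = map_matrix s_inv (on_image P' (mat (s z)))"
      unfolding x_at[OF z] using \<psi>_galois[OF inv.s in_G[OF yT] yQ] sz by (simp add: \<psi>y)
    also have "on_image P' (mat (s z)) = map_matrix s (on_image A (mat z))"
      by (simp add: map_on_image[OF mat_Qbar[OF z(1)]] map_matrix_mat)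
    also have "map_matrix s_inv \<dots> = on_image A (mat z)"
    proof -
      have "entries_in Qbar (on_image A (mat z))"
        unfolding on_image_def
        by (intro entries_in_add entries_in_mult entries_in_diff mat_Qbar z(1) AQ one_Qbar subfield_C_Qbar)
      then show ?thesis
        by (simp add: vec_eq_iff entries_in_def s_inv_s)
    qed
    finally show ?thesis .
  qed
  have \<psi>x: "\<psi> (x z) = on_image A (mat z)" if "z \<noteq> 0" for z
  proof (rule laurent_mat_eq[OF \<psi>_cochar_laurent[OF x_cochar] _ \<psi>x_Qbar that])
    show "laurent_mat Qbar (\<lambda>z. on_image A (mat z))"
      unfolding on_image_def
      by (intro laurent_mat_add laurent_mat_mult laurent_mat_const laurent_mat_scalar AQ
          entries_in_diff one_Qbar subfield_C_Qbar)
  qed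
  have "of_int (pairing \<eta> (weyl_galois_act n s b)) = - trace (N ** A)"
    if b: "b \<in> cocharacters T" and N: "mat_deriv (\<lambda>z. \<psi> (b z)) N" for b N
  proof -
    obtain m where m: "trace (N ** A) = of_int m"
      "\<And>z. z \<noteq> 0 \<Longrightarrow> det (on_image A (\<psi> (b z))) = z powi m"
      using det_cochar[OF b N x_cochar \<psi>x A_idem] by blast
    have "pairing \<eta> (weyl_galois_act n s b) = - m"
    proof (rule pairing_eq)
      fix z assume z: "z \<in> Qbar" "z \<noteq> 0"
      define w where "w = s_inv z"
      have w: "w \<in> Qbar" "w \<noteq> 0" and sw: "s w = z"
        using z by (auto simp: w_def s_inv_closed s_s_inv inv.eq_0_iff)
      have bw: "b w \<in> T" "entries_in Qbar (b w)"
        using cocharacter_closed[OF b w(2)] cochar_points[OF b w] by auto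
      have sbw: "map_matrix s (b w) \<in> T"
        by (rule zariski_closed_stable[OF alg_group_zariski_closed[OF T] bw])
      have \<psi>bw: "entries_in Qbar (\<psi> (b w))"
        by (rule \<psi>_entries[OF in_G[OF bw(1)] bw(2)])
      have "\<psi> (weyl_galois_act n s b z) = M ** map_matrix s (\<psi> (b w)) ** matrix_inv M"
        using \<psi>_conj[OF nG in_G[OF sbw]] \<psi>_galois[OF s in_G[OF bw(1)] bw(2)]
        by (simp add: weyl_galois_act_def w_def s_inv_def M_def)
      then have "det (on_image P (\<psi> (weyl_galois_act n s b z))) = det (on_image P' (map_matrix s (\<psi> (b w))))"
        by (simp add: on_image_conj[OF M(1)] det_conj[OF M(1)] P'_def)
      also have "\<dots> = det (map_matrix s (on_image A (\<psi> (b w))))"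
        by (simp add: map_on_image[OF \<psi>bw])
      \<comment> \<open>The determinant has integer coefficients, so \<open>s\<close> comes out of
        it. What remains is a power of \<open>w\<close>, and \<open>s\<close> turns it into the same
        power of \<open>z\<close>.\<close>
      also have "\<dots> = s (det (on_image A (\<psi> (b w))))"
        unfolding on_image_def
        by (intro det_equivariant entries_in_add entries_in_mult entries_in_diff AQ one_Qbar \<psi>bw subfield_C_Qbar)
      also have "\<dots> = z powi m"
        using w sw by (simp add: m(2) power_int)
      finally show "\<eta> (weyl_galois_act n s b z) = z powi (- m)"
        by (simp add: \<eta>_def power_int_minus)
    qed
    then show ?thesis
      using m(1) by simp
  qed
  then show ?thesis
    using that x_cochar \<psi>x A_idem by blast
qed

text \<open>The element realising the reflection lies in G, so on V the reflection becomes
  conjugation by an invertible matrix, and such a conjugation preserves the trace form.\<close>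

lemma coroot_reflection:
  assumes b: "is_coroot G T a b"
  obtains M where "invertible M"
    "\<And>l z. l \<in> cocharacters T \<Longrightarrow> z \<noteq> 0 \<Longrightarrow>
      M ** \<psi> (l z) ** matrix_inv M = \<psi> (l z) ** \<psi> (b (z powi (- pairing a l)))"
proof -
  have bT: "b \<in> cocharacters T"
    using b by (simp add: is_coroot_def)
  obtain n where n: "n \<in> points Qbar (normalizer
        (mgroup (centralizer G (identity_component {t\<in>T. a t = 1}))) T)"
    and refl: "\<And>l z. l \<in> cocharacters T \<Longrightarrow> z \<noteq> 0 \<Longrightarrow> conj_by n (l z) = l z ** b (z powi (- pairing a l))"
    using b unfolding is_coroot_def by blast
  have nG: "n \<in> G"
    using n by (simp add: points_def normalizer_def stabilizer_def mgroup_def centralizer_def)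
  show ?thesis
  proof
    show "invertible (\<psi> n)"
      by (rule \<psi>_invertible[OF nG])
    show "\<psi> n ** \<psi> (l z) ** matrix_inv (\<psi> n) = \<psi> (l z) ** \<psi> (b (z powi (- pairing a l)))"
      if l: "l \<in> cocharacters T" and z: "z \<noteq> 0" for l z
      using refl[OF l z] \<psi>_conj[OF nG in_G[OF cocharacter_closed[OF l z]]] z
        \<psi>_mult[OF in_G[OF cocharacter_closed[OF l z]] in_G[OF cocharacter_closed[OF bT]]]
      by (metis power_int_eq_0_iff)
  qed
qed

text \<open>Differentiating the reflection formula at 1 makes it additive. It is applied to
  \<open>l\<close> and to \<open>b\<close> itself, where \<langle>a, b\<rangle> = 2 gives the factor
  -2 that \<open>reflection_trace\<close> asks for.\<close>

lemma coroot_trace: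
  assumes b: "is_coroot G T a b" and N: "mat_deriv (\<lambda>z. \<psi> (b z)) N"
    and l: "l \<in> cocharacters T" and D: "mat_deriv (\<lambda>z. \<psi> (l z)) D"
  shows "2 * trace (D ** N) = of_int (pairing a l) * trace (N ** N)"
proof -
  have bT: "b \<in> cocharacters T" and ab: "pairing a b = 2"
    using b by (auto simp: is_coroot_def)
  obtain M where M: "invertible M" and refl: "\<And>l z. l \<in> cocharacters T \<Longrightarrow> z \<noteq> 0 \<Longrightarrow>
      M ** \<psi> (l z) ** matrix_inv M = \<psi> (l z) ** \<psi> (b (z powi (- pairing a l)))"
    using coroot_reflection[OF b] by blast
  have "M ** D ** matrix_inv M = D + mat (- of_int (pairing a l)) ** N"
    if l: "l \<in> cocharacters T" and D: "mat_deriv (\<lambda>z. \<psi> (l z)) D" for l D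
  proof (rule mat_deriv_unique)
    show "mat_deriv (\<lambda>z. M ** \<psi> (l z) ** matrix_inv M) (M ** D ** matrix_inv M)"
      using mat_deriv_mult[OF mat_deriv_mult[OF mat_deriv_const[of M] D] mat_deriv_const[of "matrix_inv M"]]
      by simp
    have "mat_deriv (\<lambda>z. \<psi> (l z) ** \<psi> (b (z powi (- pairing a l))))
        (D + mat (- of_int (pairing a l)) ** N)"
      using mat_deriv_mult[OF D mat_deriv_power_int[OF N, of "- pairing a l"]]
        cochar_one[OF l] cochar_one[OF bT] \<psi>_one by simp
    then show "mat_deriv (\<lambda>z. M ** \<psi> (l z) ** matrix_inv M) (D + mat (- of_int (pairing a l)) ** N)"
      by (rule mat_deriv_cong) (simp add: refl[OF l])
  qed
  from reflection_trace[OF M _ this[OF l D]] this[OF bT N] ab show ?thesis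
    by simp
qed

text \<open>Both \<open>x\<close> and its reflection have weights 0 and 1. At a nontrivial root of unity of order
  dividing \<open>\<langle>a, x\<rangle>\<close> they take the same value, hence they are equal.\<close>

lemma coroot_minuscule:
  assumes a: "a \<in> characters T" and b: "is_coroot G T a b"
    and x: "x \<in> cocharacters T" and \<psi>x: "\<And>z. z \<noteq> 0 \<Longrightarrow> \<psi> (x z) = on_image A (mat z)"
  shows "pairing a x \<in> {-1, 0, 1}"
proof (rule ccontr)
  define k where "k = - pairing a x"
  assume "pairing a x \<notin> {-1, 0, 1}"
  then have k: "k \<notin> {-1, 0, 1}"
    by (auto simp: k_def)
  have bT: "b \<in> cocharacters T" and ab: "pairing a b = 2"
    using b by (auto simp: is_coroot_def)
  obtain M where M: "invertible M" and "\<And>l z. l \<in> cocharacters T \<Longrightarrow> z \<noteq> 0 \<Longrightarrow>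
      M ** \<psi> (l z) ** matrix_inv M = \<psi> (l z) ** \<psi> (b (z powi (- pairing a l)))"
    using coroot_reflection[OF b] by blast
  from this(2)[OF x] have refl: "M ** on_image A (mat z) ** matrix_inv M = \<psi> (x z) ** \<psi> (b (z powi k))"
    if "z \<noteq> 0" for z
    using that by (simp add: \<psi>x k_def)
  \<comment> \<open>The projection belonging to the reflected cocharacter, which again has weights 0
    and 1.\<close>
  define B where "B = M ** A ** matrix_inv M"
  have refl': "on_image B (mat z) = on_image A (mat z) ** \<psi> (b (z powi k))" if "z \<noteq> 0" for z
  proof -
    have "M ** on_image A (mat z) ** matrix_inv M =
        mat z ** M ** A ** matrix_inv M + (M ** matrix_inv M - M ** A ** matrix_inv M)"
      by (simp add: on_image_def matrix_add_ldistrib matrix_add_right_distrib matrix_diff_left_distrib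
          matrix_diff_right_distrib matrix_mul_assoc mat_mult_commute[of z M])
    also have "\<dots> = on_image B (mat z)"
      by (simp add: on_image_def B_def matrix_inv_right[OF M] matrix_mul_assoc)
    finally show ?thesis
      using refl[OF that] \<psi>x[OF that] by simp
  qed
  have b1: "\<psi> (b 1) = mat 1"
    using cochar_one[OF bT] \<psi>_one by simp
  obtain z :: complex where z: "z \<noteq> 1" "z \<noteq> 0" "z powi k = 1"
    using exists_nontrivial_root_of_unity[OF k] by blast
  \<comment> \<open>At this root of unity the correction factor is \<open>\<psi> (b 1)\<close>, the
    identity, and z different from 1 allows the projections to be read off.\<close>
  have "B = A"
    using refl'[OF z(2)] unfolding z(3) b1 matrix_mul_rid by (rule on_image_mat_eq_iff[OF _ z(1)])
  \<comment> \<open>With \<open>B = A\<close> the correction factor is trivial for every z. Since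
    \<open>k\<close> is nonzero, each \<open>w\<close> is a \<open>k\<close>-th power, and
    injectivity of \<psi> makes \<open>b\<close> trivial.\<close>
  have "b w = mat 1" if w: "w \<noteq> 0" for w
  proof -
    obtain z :: complex where z: "z \<noteq> 0" "z powi k = w"
      using exists_root_power_int[of k w] k w by blast
    have "invertible (\<psi> (x z))"
      using \<psi>_invertible in_G cocharacter_closed[OF x z(1)] by blast
    moreover have "\<psi> (x z) ** \<psi> (b w) = \<psi> (x z)"
      using refl'[OF z(1)] \<open>B = A\<close> \<psi>x[OF z(1)] z(2) by simp
    ultimately have "matrix_inv (\<psi> (x z)) ** (\<psi> (x z) ** \<psi> (b w)) = mat 1"
      by (simp add: matrix_inv_left)
    then have "\<psi> (b w) = \<psi> (mat 1)"
      by (simp add: matrix_mul_assoc matrix_inv_left[OF \<open>invertible (\<psi> (x z))\<close>] \<psi>_one)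
    then show ?thesis
      by (rule inj_onD[OF \<psi>_inj _ in_G[OF cocharacter_closed[OF bT w]] alg_group_one[OF G]])
  qed
  moreover have "a (mat 1) = 1"
  proof -
    have hom: "alg_hom Qbar T Gm (\<lambda>t. mat (a t))"
      using a by (simp add: characters_def)
    have one: "mat 1 \<in> T"
      by (rule alg_group_one[OF T])
    have "a (mat 1) \<noteq> 0"
      using alg_hom_closed[OF hom one] by (simp add: Gm_iff mat_1_entry)
    moreover have "a (mat 1) * a (mat 1) = a (mat 1)"
      using arg_cong[OF alg_hom_mult[OF hom one one], of "\<lambda>A. A $ 1 $ 1", symmetric]
      unfolding mat_mult_mat mat_1_entry mult_1_left .
    ultimately show ?thesis
      by simp
  qed
  ultimately have "pairing a b = 0"
    by (intro pairing_eq) simp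
  then show False
    using ab by simp
qed

lemma pairing_ratio:
  assumes a: "a \<in> characters T" and b: "is_coroot G T a b" and nz: "pairing \<eta> b \<noteq> 0"
    and n: "n \<in> points Qbar (normalizer (mgroup G) T)" and s: "s \<in> Gal_Qbar"
  shows "rat_of_int (pairing \<eta> (weyl_galois_act n s b)) / rat_of_int (pairing \<eta> b) \<in> {-1, 0, 1}"
proof (rule weyl_galois_transport[OF n s])
  fix x A
  assume x: "x \<in> cocharacters T" "\<And>z. z \<noteq> 0 \<Longrightarrow> \<psi> (x z) = on_image A (mat z)"
    and act: "\<And>b N. b \<in> cocharacters T \<Longrightarrow> mat_deriv (\<lambda>z. \<psi> (b z)) N \<Longrightarrow>
      of_int (pairing \<eta> (weyl_galois_act n s b)) = - trace (N ** A)"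
  have bT: "b \<in> cocharacters T"
    using b by (simp add: is_coroot_def)
  obtain N where N: "mat_deriv (\<lambda>z. \<psi> (b z)) N"
    using laurent_mat_deriv[OF \<psi>_cochar_laurent[OF bT]] by blast
  have deriv: "mat_deriv (\<lambda>z. \<psi> (l z)) B" if "\<And>z. z \<noteq> 0 \<Longrightarrow> \<psi> (l z) = on_image B (mat z)" for l B
    by (rule mat_deriv_cong[OF on_image_mat_deriv]) (simp add: that)
  define j k where "j = pairing a \<mu>" and "k = pairing a x"
  have jk: "j \<in> {-1, 0, 1}" "k \<in> {-1, 0, 1}"
    unfolding j_def k_def using coroot_minuscule[OF a b \<mu> \<psi>\<mu>] coroot_minuscule[OF a b x] by auto
  define p q where "p = pairing \<eta> b" and "q = pairing \<eta> (weyl_galois_act n s b)"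
  have "2 * trace (P ** N) = of_int j * trace (N ** N)"
    unfolding j_def by (rule coroot_trace[OF b N \<mu> deriv[OF \<psi>\<mu>]])
  then have p: "- 2 * of_int p = of_int j * trace (N ** N)"
    unfolding p_def pairing_\<eta>[OF bT N] by (simp add: trace_mul_sym[of N P])
  have "2 * trace (A ** N) = of_int k * trace (N ** N)"
    unfolding k_def by (rule coroot_trace[OF b N x(1) deriv[OF x(2)]])
  then have q: "- 2 * of_int q = of_int k * trace (N ** N)"
    unfolding q_def act[OF bT N] by (simp add: trace_mul_sym[of N A])
  \<comment> \<open>Cross-multiplying eliminates the squared length \<open>trace (N ** N)\<close> of
    the coroot. That \<open>j\<close> is nonzero follows from the nonvanishing of
    \<open>p\<close>.\<close>
  have "(- 2 * of_int q) * of_int j = (- 2 * of_int p) * complex_of_int k"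
    unfolding p q by (simp only: mult_ac)
  then have "complex_of_int (q * j) = of_int (p * k)"
    by simp
  then have "q * j = p * k"
    by (simp only: of_int_eq_iff)
  moreover have "j \<noteq> 0"
    using p nz by (auto simp: p_def)
  ultimately have "q \<in> {- p, 0, p}"
    using jk by auto
  then show ?thesis
    using nz unfolding p_def q_def by auto
qed

text \<open>Characters and pairings see a function only through its values on \<open>T\<close>. The
  point to check is that Weyl-Galois conjugates of coroots stay in \<open>T\<close> at algebraic
  arguments.\<close>

lemma quasi_constant_if_eq_\<eta>:
  assumes c: "\<And>t. t \<in> T \<Longrightarrow> c t = \<eta> t"
  shows "quasi_constant G T c"
proof -
  have char: "c \<in> characters T"
  proof -
    have "alg_hom Qbar T Gm (\<lambda>t. mat (\<eta> t))"
      using \<eta>_character by (simp add: characters_def)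
    then have "alg_hom Qbar T Gm (\<lambda>t. mat (c t))"
      using alg_group_mult[OF T]
      by (simp add: alg_hom_def hom_def Pi_def mgroup_def GL_def regular_on_def c)
    then show ?thesis
      by (simp add: characters_def)
  qed
  have eq: "pairing c l = pairing \<eta> l" if "\<And>z. z \<in> Qbar \<Longrightarrow> z \<noteq> 0 \<Longrightarrow> l z \<in> T" for l
  proof -
    have "(\<forall>z \<in> Qbar - {0}. c (l z) = z powi k) \<longleftrightarrow> (\<forall>z \<in> Qbar - {0}. \<eta> (l z) = z powi k)" for k
      using that c by (intro ball_cong) auto
    then show ?thesis
      by (simp only: pairing_def)
  qed
  have act: "weyl_galois_act n s b z \<in> T"
    if "n \<in> points Qbar (normalizer (mgroup G) T)" "s \<in> Gal_Qbar" "b \<in> cocharacters T" "z \<in> Qbar" "z \<noteq> 0"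
    for n s b z
  proof -
    interpret galois s
      using that(2) by unfold_locales
    have w: "s_inv z \<in> Qbar" "s_inv z \<noteq> 0"
      using that(4,5) by (auto simp: s_inv_closed galois.eq_0_iff[OF galois_s_inv])
    have "map_matrix s (b (s_inv z)) \<in> T"
      by (rule zariski_closed_stable[OF alg_group_zariski_closed[OF T]
            cocharacter_closed[OF that(3) w(2)] cochar_points[OF that(3) w]])
    then show ?thesis
      using normalizer_conj[OF G _ TG] that(1) by (simp add: weyl_galois_act_def s_inv_def points_def)
  qed
  show ?thesis
    unfolding quasi_constant_def
  proof (intro conjI char ballI allI impI)
    fix a b n s
    assume "a \<in> roots G T" "is_coroot G T a b \<and> pairing c b \<noteq> 0"
      and n: "n \<in> points Qbar (normalizer (mgroup G) T)" and s: "s \<in> Gal_Qbar"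
    then have a: "a \<in> characters T" and b: "is_coroot G T a b" "pairing c b \<noteq> 0"
      by (auto simp: roots_def)
    have bT: "b \<in> cocharacters T"
      using b by (simp add: is_coroot_def)
    have "pairing c b = pairing \<eta> b"
      using cocharacter_closed[OF bT] by (intro eq)
    moreover have "pairing c (weyl_galois_act n s b) = pairing \<eta> (weyl_galois_act n s b)"
      by (intro eq act n s bT)
    ultimately show "rat_of_int (pairing c (weyl_galois_act n s b)) / rat_of_int (pairing c b) \<in> {-1, 0, 1}"
      using pairing_ratio[OF a b(1) _ n s] b(2) by simp
  qed
qed

end


section \<open>From Hodge structures to the weights of \<mu>\<close>

lemma deligne_pt_in_torus:
  assumes "z \<noteq> 0" "w \<noteq> 0"
  shows "deligne_pt z w \<in> deligne_torus"
proof -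
  have "det (deligne_pt z w) = z * w"
    by (simp add: det_2 deligne_pt_def field_simps power2_eq_square)
  then have "invertible (deligne_pt z w)"
    using assms by (simp add: invertible_det_nz)
  moreover have "deligne_pt z w $ 1 $ 1 = deligne_pt z w $ 2 $ 2"
    "deligne_pt z w $ 1 $ 2 = - deligne_pt z w $ 2 $ 1"
    by (simp_all add: deligne_pt_def field_simps)
  ultimately show ?thesis
    by (simp add: deligne_torus_def)
qed

text \<open>Setting the second coordinate to 1 leaves the scalar z on type (-1, 0) and 1 on type (0,
  -1).\<close>

lemma siegel_hom_weights:
  assumes "h \<in> siegel_homs J"
  obtains x y where "v = x + y"
    "\<And>z. z \<noteq> 0 \<Longrightarrow> h (deligne_pt z 1) *v x = z *s x" "\<And>z. z \<noteq> 0 \<Longrightarrow> h (deligne_pt z 1) *v y = y"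
proof -
  have "has_hodge_types (*s) (\<lambda>z w v. h (deligne_pt z w) *v v) UNIV {(-1, 0), (0, -1)}"
    using assms by (simp add: siegel_homs_def)
  then obtain u where u: "\<forall>pq\<in>{(-1, 0), (0, -1)}. u pq \<in>
      hodge_component (*s) (\<lambda>z w v. h (deligne_pt z w) *v v) UNIV pq"
    and v: "v = (\<Sum>pq\<in>{(-1, 0), (0, -1)}. u pq)"
    unfolding has_hodge_types_def by blast
  show ?thesis
  proof (rule that)
    show "v = u (-1, 0) + u (0, -1)"
      using v by simp
    show "h (deligne_pt z 1) *v u (-1, 0) = z *s u (-1, 0)" if "z \<noteq> 0" for z
      using u that by (simp add: hodge_component_def)
    show "h (deligne_pt z 1) *v u (0, -1) = u (0, -1)" if "z \<noteq> 0" for z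
      using u that by (simp add: hodge_component_def)
  qed
qed

text \<open>Commutativity puts \<open>t\<close> and \<open>\<psi> t\<close> into the two
  centralizers, so both restricted functions take their genuine values instead of
  \<open>undefined\<close>. The subspace \<open>V10\<close> is the fixed space of \<open>P\<close>,
  where \<open>det_on_eq_det\<close> applies.\<close>

lemma (in hodge_embedding) hodge_character_eq:
  assumes "H = GSp J" and t: "t \<in> T"
  shows "hodge_character G J \<psi> \<mu> t = \<eta> t"
proof -
  have comm: "t ** \<mu> z = \<mu> z ** t" if "z \<noteq> 0" for z
    using T_commute t cocharacter_closed[OF \<mu> that] by blast
  have "t \<in> cent_cochar G \<mu>"
    using in_G[OF t] comm by (auto simp: cent_cochar_def centralizer_def)
  moreover have "\<psi> t ** \<psi> (\<mu> z) = \<psi> (\<mu> z) ** \<psi> t" if "z \<noteq> 0" for z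
    using \<psi>_mult[OF in_G[OF t] in_G[OF cocharacter_closed[OF \<mu> that]]]
      \<psi>_mult[OF in_G[OF cocharacter_closed[OF \<mu> that]] in_G[OF t]] comm[OF that] by simp
  then have "\<psi> t \<in> cent_cochar (GSp J) (\<psi> \<circ> \<mu>)"
    using alg_hom_closed[OF \<psi> in_G[OF t]] assms(1) by (auto simp: cent_cochar_def centralizer_def)
  moreover have "V10 (\<psi> \<circ> \<mu>) = {v. P *v v = v}"
  proof (intro subset_antisym subsetI)
    fix v assume "v \<in> V10 (\<psi> \<circ> \<mu>)"
    then have "\<psi> (\<mu> 2) *v v = v + v"
      by (simp add: V10_def vec_eq_iff)
    then show "v \<in> {v. P *v v = v}"
      by (simp add: P_eq matrix_vector_mult_diff_rdistrib)
  next
    fix v assume "v \<in> {v. P *v v = v}"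
    then show "v \<in> V10 (\<psi> \<circ> \<mu>)"
      by (simp add: V10_def \<psi>\<mu> on_image_def matrix_vector_mult_add_rdistrib
          matrix_vector_mult_diff_rdistrib mat_vector_mult)
  qed
  then have "det_on (V10 (\<psi> \<circ> \<mu>)) (\<psi> t) = det (on_image P (\<psi> t))"
    unfolding on_image_def by (rule det_on_eq_det[OF P_idem P_commute[OF t]])
  ultimately show ?thesis
    by (simp add: hodge_character_def siegel_hodge_character_def compose_def \<eta>_def)
qed

theorem theorem1p4p4:
  fixes G :: "(complex ^ 'm ^ 'm::finite) set"
    and X :: "(complex ^ 2 ^ 2 \<Rightarrow> complex ^ 'm ^ 'm) set"
    and J :: "rat ^ 'v ^ 'v::finite"
    and \<psi> :: "complex ^ 'm ^ 'm \<Rightarrow> complex ^ 'v ^ 'v"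
    and T :: "(complex ^ 'm ^ 'm) set"
    and \<mu> :: "complex \<Rightarrow> complex ^ 'm ^ 'm"
  assumes "shimura_datum G X"
    and "of_hodge_type TYPE('w::finite) G X"
    and "symplectic_form J"
    and "symplectic_embedding G X J \<psi>"
    and "maximal_torus \<rat> G T"
    and "\<mu> \<in> cocharacters T"
    and "\<exists>h\<in>X. \<exists>g\<in>G. \<forall>z. z \<noteq> 0 \<longrightarrow> \<mu> z = conj_by g (hodge_cochar h z)"
  shows "quasi_constant G T (hodge_character G J \<psi> \<mu>)"
proof -
  have G: "alg_group \<rat> G"
    using assms(1) by (simp add: shimura_datum_def)
  have T: "alg_group \<rat> T" "T \<subseteq> G" "torus T"
    using assms(5) by (auto simp: maximal_torus_def)
  have \<psi>: "alg_hom \<rat> G (GSp J) \<psi>" "inj_on \<psi> G"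
    and siegel: "\<And>h. h \<in> X \<Longrightarrow> compose deligne_torus \<psi> h \<in> siegel_homs J"
    using assms(4) by (auto simp: symplectic_embedding_def)
  obtain h g where h: "h \<in> X" and g: "g \<in> G"
    and \<mu>: "\<And>z. z \<noteq> 0 \<Longrightarrow> \<mu> z = conj_by g (hodge_cochar h z)"
    using assms(7) by blast
  obtain h0 g0 where h0: "alg_hom \<real> deligne_torus G h0" and g0: "g0 \<in> G"
    and h_eq: "h = restrict (\<lambda>s. conj_by g0 (h0 s)) deligne_torus"
    using assms(1) h by (auto simp: shimura_datum_def points_def)
  have hG: "h s \<in> G" if "s \<in> deligne_torus" for s
    using alg_hom_closed[OF h0 that] that g0
    by (simp add: h_eq conj_by_def alg_group_mult[OF G] alg_group_inv[OF G])
  \<comment> \<open>The conjugating element \<open>g\<close> is only a complex point of G, but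
    \<psi> still turns it into an isomorphism between the two representations of the multiplicative
    group on V.\<close>
  have intertwine: "\<psi> (\<mu> z) ** \<psi> g = \<psi> g ** \<psi> (h (deligne_pt z 1))" if "z \<noteq> 0" for z
  proof -
    have d: "h (deligne_pt z 1) \<in> G"
      using hG deligne_pt_in_torus[OF that] by simp
    have "\<mu> z ** g = g ** h (deligne_pt z 1) ** (matrix_inv g ** g)"
      using \<mu>[OF that] by (simp add: conj_by_def hodge_cochar_def matrix_mul_assoc)
    then have "\<mu> z ** g = g ** h (deligne_pt z 1)"
      by (simp add: matrix_inv_left[OF alg_group_invertible[OF G g]])
    moreover have "\<mu> z \<in> G"
      using cocharacter_closed[OF assms(6) that] T(2) by blast
    ultimately show ?thesis
      using alg_hom_mult[OF \<psi>(1) _ g] alg_hom_mult[OF \<psi>(1) g d] by metis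
  qed
  have invertible_GSp: "invertible A" if "A \<in> GSp J" for A
    using that by (simp add: GSp_def)
  define P where "P = \<psi> (\<mu> 2) - mat 1"
  have weights: "\<exists>x y. v = x + y \<and> (\<forall>z. z \<noteq> 0 \<longrightarrow> \<psi> (\<mu> z) *v x = z *s x \<and> \<psi> (\<mu> z) *v y = y)" for v
  proof -
    \<comment> \<open>Decompose by the Hodge structure of \<open>h\<close> after applying the
      inverse of \<open>\<psi> g\<close>, then carry the components back.\<close>
    obtain x y where xy: "matrix_inv (\<psi> g) *v v = x + y"
      "\<And>z. z \<noteq> 0 \<Longrightarrow> compose deligne_torus \<psi> h (deligne_pt z 1) *v x = z *s x"
      "\<And>z. z \<noteq> 0 \<Longrightarrow> compose deligne_torus \<psi> h (deligne_pt z 1) *v y = y"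
      using siegel_hom_weights[OF siegel[OF h], of "matrix_inv (\<psi> g) *v v"] by metis
    have "v = \<psi> g *v (matrix_inv (\<psi> g) *v v)"
      by (simp add: matrix_vector_mul_assoc
          matrix_inv_right[OF invertible_GSp[OF alg_hom_closed[OF \<psi>(1) g]]])
    then have "v = \<psi> g *v x + \<psi> g *v y"
      by (simp add: xy(1) matrix_vector_right_distrib)
    moreover have "\<psi> (\<mu> z) *v (\<psi> g *v u) = \<psi> g *v (compose deligne_torus \<psi> h (deligne_pt z 1) *v u)"
      if "z \<noteq> 0" for z u
      using intertwine[OF that] deligne_pt_in_torus[OF that, of 1]
      by (simp add: matrix_vector_mul_assoc compose_def)
    ultimately show ?thesis
      using xy(2,3) by (intro exI[of _ "\<psi> g *v x"] exI[of _ "\<psi> g *v y"]) (simp add: vec.scale)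
  qed
  interpret hodge_embedding G T "GSp J" \<psi> \<mu> P
  proof
    show "P ** P = P"
      by (rule weights_zero_one(1)[OF weights P_def])
    show "\<psi> (\<mu> z) = on_image P (mat z)" if "z \<noteq> 0" for z
      by (rule weights_zero_one(2)[OF weights P_def that])
  qed (use G T \<psi> assms(6) invertible_GSp torus_commute in auto)
  show ?thesis
    by (rule quasi_constant_if_eq_\<eta>[OF hodge_character_eq[OF refl]])
qed

end
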